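(* Consider the multistage stochastic AC optimal power flow setting and the problems $(P)$, $(P_{\mathrm{SOC}})$, $(P'_{\mathrm{SOC}})$ described in the context. Assume: 1. the network is radial and connected; 2. the network is passive, i.e. $\Re(z_{i,j})\ge 0$ and $\Im(z_{i,j})\ge 0$ for all lines $(i,j)\in\mathcal E$; 3. the cost function $C$ is convex, component-wise monotone non-increasing in $\Re(S)$, $\Im(S)$ and $v$, and component-wise monotone non-decreasing in $\mathcal I$, $\Re(s_0)$, $\Im(s_0)$ and $|S|$. Then the relaxation gap of $(P)$, given by $val(P)-val(P_{\mathrm{SOC}})$, satisfies $$val(P)-val(P_{\mathrm{SOC}})\le val(P'_{\mathrm{SOC}})-val(P_{\mathrm{SOC}}).$$
   Context: Network. $\mathcal B=\{0,1,\dots,n\}$ is the set of buses, bus $0$ being the slack (reference) bus. $\mathcal E$ is the set of edges. The network is radial and connected: it is a tree, rooted at $0$, with every edge directed towards the root, so for each $i\in\mathcal B\setminus\{0\}$ there is exactly one edge $(i,j)\in\mathcal E$ leaving $i$ ($j$ is the parent of $i$). Edge $(i,j)$ has impedance $z_{i,j}\in\mathbb C$. For a bus $i$, $\mathcal E_i$ is the set of edges of the sub-tree starting from $i$, i.e. edges $(k,l)\in\mathcal E$ with both endpoints among $i$ and its descendants (so the edge from $i$ to its parent is not in $\mathcal E_i$). $z^*$ is the complex conjugate, $\mathbf i^2=-1$. Time and scenarios. $\mathcal T=\{0,1,\dots,T\}$; step $t$ has duration $\Delta_t>0$. $\Omega$ is a finite set of scenarios with given probabilities, and $\mathbb E$ is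 the corresponding expectation. Each $\omega\in\Omega$ carries an exogenous trajectory $(\xi_{t,\omega})_{t\in\mathcal T}$; $\omega,\omega'$ are indistinguishable up to time $t$ if $\xi_{\tau,\omega}=\xi_{\tau,\omega'}$ for all $\tau\le t$. A family $y=(y_{t,\omega})$ is non-anticipative if $y_{t,\omega}=y_{t,\omega'}$ for all $t$ and all $\omega,\omega'$ indistinguishable up to time $t$. Data. Real bounds $\underline v_i,\overline v_i$ (with $\underline v_i>0$), $\overline{\mathcal I}_{(i,j)}$, $\overline S_{(i,j)}$, $\overline p^{\mathrm{inj}}_i$, $\overline p^{\mathrm{abs}}_i$, $\underline q_i,\overline q_i$, $\underline X_i,\overline X_i$; real efficiencies $\rho^{\mathrm{abs}}_i,\rho^{\mathrm{inj}}_i$; initial states of charge $x_i$; complex exogenous demands $s^d_{i,t,\omega}$. Variables. $y=(s_0,s,p^{\mathrm{inj}},p^{\mathrm{abs}},q,X,S,\mathcal I,v)$, where $s_{0,t,\omega}\in\mathbb C$; for $i\in\mathcal B\setminus\{0\}$, $s_{i,t,\omega}\in\mathbb C$ and $p^{\mathrm{inj}}_{i,t,\omega},p^{\mathrm{abs}}_{i,t,\omega},q_{i,t,\omega},X_{i,t,\omega}\in\mathbb R$; for $(i,j)\in\mathcal E$, $S_{(i,j),t,\omega}\in\mathbb C$ and $\mathcal I_{(i,j),t,\omega}\in\mathbb R$; for $i\in\mathcal B$, $v_{i,t,\omega}\in\mathbb R$. Base constraints, for all $t\in\mathcal T$, $\omega\in\Omega$: (a) $v_{0,t,\omega}=1$,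 and $\underline v_i\le v_{i,t,\omega}\le\overline v_i$ for $i\ne0$; (b) $0\le\mathcal I_{(i,j),t,\omega}\le\overline{\mathcal I}_{(i,j)}$ and $|S_{(i,j),t,\omega}|\le\overline S_{(i,j)}$ for $(i,j)\in\mathcal E$; (c) $0\le p^{\mathrm{inj}}_{i,t,\omega}\le\overline p^{\mathrm{inj}}_i$, $0\le p^{\mathrm{abs}}_{i,t,\omega}\le\overline p^{\mathrm{abs}}_i$, $\underline q_i\le q_{i,t,\omega}\le\overline q_i$ for $i\ne0$; (d) for $i\ne 0$: $X_{i,t+1,\omega}=X_{i,t,\omega}+\rho^{\mathrm{abs}}_i p^{\mathrm{abs}}_{i,t,\omega}\Delta_t-\rho^{\mathrm{inj}}_i p^{\mathrm{inj}}_{i,t,\omega}\Delta_t$ if $t<T$; $X_{i,0,\omega}=x_i$; $\underline X_i\le X_{i,t,\omega}\le\overline X_i$; (e) $s_{i,t,\omega}=p^{\mathrm{inj}}_{i,t,\omega}-p^{\mathrm{abs}}_{i,t,\omega}+\mathbf i q_{i,t,\omega}-s^d_{i,t,\omega}$ for $i\ne0$; (f) $S_{(i,j),t,\omega}=\sum_{(k,i)\in\mathcal E}(S_{(k,i),t,\omega}-z_{k,i}\mathcal I_{(k,i),t,\omega})+s_{i,t,\omega}$ for $(i,j)\in\mathcal E$, and $0=\sum_{(k,0)\in\mathcal E}(S_{(k,0),t,\omega}-z_{k,0}\mathcal I_{(k,0),t,\omega})+s_{0,t,\omega}$; (g) $v_{i,t,\omega}-v_{j,t,\omega}=2\Re(z_{i,j}^*S_{(i,j),t,\omega})-|z_{i,j}|^2\mathcal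 I_{(i,j),t,\omega}$ for $(i,j)\in\mathcal E$; (h) $y$ is non-anticipative. Non-convex constraint (NC): $v_{i,t,\omega}\mathcal I_{(i,j),t,\omega}=|S_{(i,j),t,\omega}|^2$ for all $(i,j)\in\mathcal E,t,\omega$. Relaxed constraint (SOC): $v_{i,t,\omega}\mathcal I_{(i,j),t,\omega}\ge|S_{(i,j),t,\omega}|^2$ for all $(i,j)\in\mathcal E,t,\omega$. Restriction constraints, with additional variables $s^{\mathrm{Lin}}_{0,t,\omega}\in\mathbb C$, $v^{\mathrm{Lin}}_{i,t,\omega}\in\mathbb R$ ($i\in\mathcal B$), $S^{\mathrm{Lin}}_{(i,j),t,\omega}\in\mathbb C$ ($(i,j)\in\mathcal E$), for all $t,\omega$: (L1) $v^{\mathrm{Lin}}_{0,t,\omega}=1$; (L2) $v^{\mathrm{Lin}}_{i,t,\omega}\le\overline v_i$ for $i\in\mathcal B$; (L3) $S^{\mathrm{Lin}}_{(i,j),t,\omega}=\sum_{(k,i)\in\mathcal E}S^{\mathrm{Lin}}_{(k,i),t,\omega}+s_{i,t,\omega}$ for $(i,j)\in\mathcal E$; (L4) $0=\sum_{(k,0)\in\mathcal E}S^{\mathrm{Lin}}_{(k,0),t,\omega}+s^{\mathrm{Lin}}_{0,t,\omega}$; (L5) $v^{\mathrm{Lin}}_{i,t,\omega}-v^{\mathrm{Lin}}_{j,t,\omega}=2\Re(z_{i,j}^*S^{\mathrm{Lin}}_{(i,j),t,\omega})$ for $(i,j)\in\mathcal E$; (L6) $\Re(z_{k,l}^*S^{\mathrm{Lin}}_{(i,j),t,\omega})\le0$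 for all $(i,j)\in\mathcal E$, $(k,l)\in\mathcal E_i$. Cost. $C$ is a real-valued convex function of the decision variables $(s_0,p^{\mathrm{inj}},p^{\mathrm{abs}},q,X,S,\mathcal I,v)$ of a scenario; it may depend on $\omega$ (in a progressively measurable way, i.e. adapted to the information $\xi$ revealed over time). It does not depend on the Lin variables. The monotonicity assumption on $C$ is understood by regarding $C$ as a function of $(s_0,p^{\mathrm{inj}},p^{\mathrm{abs}},q,X,\mathcal I,v)$ and of $\Re(S)$, $\Im(S)$, $|S|$ (the families of real parts, imaginary parts and moduli of the line flows) as separate arguments, and requiring monotonicity in each component of each listed argument. Problems. $(P)$: minimize $\mathbb E[C]$ over $y$ subject to (a)–(h) and (NC). $(P_{\mathrm{SOC}})$: minimize $\mathbb E[C]$ over $y$ subject to (a)–(h) and (SOC). $(P'_{\mathrm{SOC}})$: minimize $\mathbb E[C]$ over $(y,S^{\mathrm{Lin}},v^{\mathrm{Lin}},s^{\mathrm{Lin}}_0)$ (with all variables non-anticipative) subject to (a)–(h), (SOC) and (L1)–(L6). $val(\cdot)\in[-\infty,+\infty]$ is the infimum ($+\infty$ if infeasible). The differences of values are considered when $val(P_{\mathrm{SOC}})$ is finite, so that they are well defined in $(-\infty,+\infty]$. *)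

theory Defs
  imports "HOL-Probability.Probability"
begin

section \<open>Network, scenarios and data\<close>

text \<open>Scenarios are the elements of a finite type \<open>'w\<close> weighted by \<open>prob\<close>; \<open>info t \<omega>\<close> is the
  exogenous trajectory \<open>\<xi>\<close>.  Bus-indexed families take the bus (or the edge) first, then the time.\<close>

record ('w, 'x) opf_data =
  num_bus :: nat
  edges :: "(nat \<times> nat) set"
  imp :: "nat \<times> nat \<Rightarrow> complex"
  horizon :: nat
  dur :: "nat \<Rightarrow> real"
  prob :: "'w pmf"
  info :: "nat \<Rightarrow> 'w \<Rightarrow> 'x"
  v_lo :: "nat \<Rightarrow> real"
  v_hi :: "nat \<Rightarrow> real"
  I_hi :: "nat \<times> nat \<Rightarrow> real"
  S_hi :: "nat \<times> nat \<Rightarrow> real"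
  p_inj_hi :: "nat \<Rightarrow> real"
  p_abs_hi :: "nat \<Rightarrow> real"
  q_lo :: "nat \<Rightarrow> real"
  q_hi :: "nat \<Rightarrow> real"
  X_lo :: "nat \<Rightarrow> real"
  X_hi :: "nat \<Rightarrow> real"
  eff_abs :: "nat \<Rightarrow> real"
  eff_inj :: "nat \<Rightarrow> real"
  X_init :: "nat \<Rightarrow> real"
  demand :: "nat \<Rightarrow> nat \<Rightarrow> 'w \<Rightarrow> complex"

definition buses :: "('w, 'x) opf_data \<Rightarrow> nat set" where
  "buses D = {0..num_bus D}"

definition nonslack :: "('w, 'x) opf_data \<Rightarrow> nat set" where
  "nonslack D = buses D - {0}"

text \<open>A tree rooted at bus 0 with edges directed towards the root.\<close>

definition radial_connected :: "('w, 'x) opf_data \<Rightarrow> bool" where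
  "radial_connected D \<longleftrightarrow>
     edges D \<subseteq> buses D \<times> buses D \<and>
     (\<forall>i\<in>nonslack D. \<exists>!j. (i, j) \<in> edges D) \<and>
     (\<forall>j. (0, j) \<notin> edges D) \<and>
     (\<forall>i\<in>buses D. (i, 0) \<in> (edges D)\<^sup>*)"

text \<open>As an undirected graph it is therefore connected, with one edge fewer than vertices.\<close>

lemma radial_connected_undirected:
  assumes "radial_connected D" "i \<in> buses D" "j \<in> buses D"
  shows "(i, j) \<in> (edges D \<union> (edges D)\<inverse>)\<^sup>*"
proof -
  have i: "(i, 0) \<in> (edges D \<union> (edges D)\<inverse>)\<^sup>*"
    using assms unfolding radial_connected_def by (meson in_rtrancl_UnI)
  have "(j, 0) \<in> (edges D)\<^sup>*"
    using assms unfolding radial_connected_def by blast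
  then have "(0, j) \<in> ((edges D)\<inverse>)\<^sup>*"
    by (simp add: rtrancl_converse)
  then have "(0, j) \<in> (edges D \<union> (edges D)\<inverse>)\<^sup>*"
    by (meson in_rtrancl_UnI)
  with i show ?thesis by (rule rtrancl_trans)
qed

lemma radial_connected_card_edges:
  assumes "radial_connected D"
  shows "card (edges D) = num_bus D"
proof -
  have "bij_betw fst (edges D) (nonslack D)"
    unfolding bij_betw_def
  proof
    show "inj_on fst (edges D)"
    proof (rule inj_onI)
      fix e e' assume "e \<in> edges D" "e' \<in> edges D" "fst e = fst e'"
      moreover obtain i j where "e = (i, j)" by (cases e)
      moreover obtain i' j' where "e' = (i', j')" by (cases e')
      ultimately show "e = e'"
        using assms unfolding radial_connected_def nonslack_def by auto
    qed
    show "fst ` edges D = nonslack D"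
      using assms unfolding radial_connected_def nonslack_def by (force simp: image_iff)
  qed
  then have "card (edges D) = card (nonslack D)"
    by (rule bij_betw_same_card)
  then show ?thesis by (simp add: nonslack_def buses_def)
qed

definition passive_network :: "('w, 'x) opf_data \<Rightarrow> bool" where
  "passive_network D \<longleftrightarrow> (\<forall>e\<in>edges D. 0 \<le> Re (imp D e) \<and> 0 \<le> Im (imp D e))"

definition subtree_edges :: "('w, 'x) opf_data \<Rightarrow> nat \<Rightarrow> (nat \<times> nat) set" where
  "subtree_edges D i =
     {(k, l) \<in> edges D. (k, i) \<in> (edges D)\<^sup>* \<and> (l, i) \<in> (edges D)\<^sup>*}"

definition indistinguishable :: "('w, 'x) opf_data \<Rightarrow> nat \<Rightarrow> 'w \<Rightarrow> 'w \<Rightarrow> bool" where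
  "indistinguishable D t \<omega> \<omega>' \<longleftrightarrow> (\<forall>\<tau>\<le>t. info D \<tau> \<omega> = info D \<tau> \<omega>')"

definition non_anticipative :: "('w, 'x) opf_data \<Rightarrow> ('w \<Rightarrow> nat \<Rightarrow> 'a) \<Rightarrow> bool" where
  "non_anticipative D f \<longleftrightarrow>
     (\<forall>t\<le>horizon D. \<forall>\<omega> \<omega>'. indistinguishable D t \<omega> \<omega>' \<longrightarrow> f \<omega> t = f \<omega>' t)"


section \<open>Decision variables of one scenario\<close>

text \<open>The components of these families outside the buses, edges and time steps of the network
  are meaningless: no constraint mentions them, and costs are required to ignore them.\<close>

record cost_vars =
  s_slack :: "nat \<Rightarrow> complex"
  p_inj :: "nat \<Rightarrow> nat \<Rightarrow> real"
  p_abs :: "nat \<Rightarrow> nat \<Rightarrow> real"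
  q_inj :: "nat \<Rightarrow> nat \<Rightarrow> real"
  charge :: "nat \<Rightarrow> nat \<Rightarrow> real"
  line_S :: "nat \<times> nat \<Rightarrow> nat \<Rightarrow> complex"
  line_I :: "nat \<times> nat \<Rightarrow> nat \<Rightarrow> real"
  volt :: "nat \<Rightarrow> nat \<Rightarrow> real"

record flow_vars = cost_vars +
  s_bus :: "nat \<Rightarrow> nat \<Rightarrow> complex"

record lin_vars =
  lin_s_slack :: "nat \<Rightarrow> complex"
  lin_S :: "nat \<times> nat \<Rightarrow> nat \<Rightarrow> complex"
  lin_volt :: "nat \<Rightarrow> nat \<Rightarrow> real"


section \<open>Constraints\<close>

definition bound_constraints :: "('w, 'x) opf_data \<Rightarrow> flow_vars \<Rightarrow> bool" where
  "bound_constraints D y \<longleftrightarrow> (\<forall>t\<le>horizon D.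
     volt y 0 t = 1 \<and>
     (\<forall>i\<in>nonslack D.
        v_lo D i \<le> volt y i t \<and> volt y i t \<le> v_hi D i \<and>
        0 \<le> p_inj y i t \<and> p_inj y i t \<le> p_inj_hi D i \<and>
        0 \<le> p_abs y i t \<and> p_abs y i t \<le> p_abs_hi D i \<and>
        q_lo D i \<le> q_inj y i t \<and> q_inj y i t \<le> q_hi D i) \<and>
     (\<forall>e\<in>edges D.
        0 \<le> line_I y e t \<and> line_I y e t \<le> I_hi D e \<and> cmod (line_S y e t) \<le> S_hi D e))"

definition storage_constraints :: "('w, 'x) opf_data \<Rightarrow> flow_vars \<Rightarrow> bool" where
  "storage_constraints D y \<longleftrightarrow> (\<forall>i\<in>nonslack D.
     (\<forall>t<horizon D.
        charge y i (t + 1) =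
          charge y i t + eff_abs D i * p_abs y i t * dur D t - eff_inj D i * p_inj y i t * dur D t) \<and>
     charge y i 0 = X_init D i \<and>
     (\<forall>t\<le>horizon D. X_lo D i \<le> charge y i t \<and> charge y i t \<le> X_hi D i))"

definition injection_constraints :: "('w, 'x) opf_data \<Rightarrow> 'w \<Rightarrow> flow_vars \<Rightarrow> bool" where
  "injection_constraints D \<omega> y \<longleftrightarrow> (\<forall>t\<le>horizon D. \<forall>i\<in>nonslack D.
     s_bus y i t =
       of_real (p_inj y i t) - of_real (p_abs y i t) + \<i> * of_real (q_inj y i t) - demand D i t \<omega>)"

definition balance_constraints :: "('w, 'x) opf_data \<Rightarrow> flow_vars \<Rightarrow> bool" where
  "balance_constraints D y \<longleftrightarrow> (\<forall>t\<le>horizon D.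
     (\<forall>(i, j)\<in>edges D.
        line_S y (i, j) t =
          (\<Sum>k | (k, i) \<in> edges D. line_S y (k, i) t - imp D (k, i) * of_real (line_I y (k, i) t))
          + s_bus y i t) \<and>
     0 = (\<Sum>k | (k, 0) \<in> edges D. line_S y (k, 0) t - imp D (k, 0) * of_real (line_I y (k, 0) t))
         + s_slack y t)"

definition voltage_constraints :: "('w, 'x) opf_data \<Rightarrow> flow_vars \<Rightarrow> bool" where
  "voltage_constraints D y \<longleftrightarrow> (\<forall>t\<le>horizon D. \<forall>(i, j)\<in>edges D.
     volt y i t - volt y j t =
       2 * Re (cnj (imp D (i, j)) * line_S y (i, j) t) - (cmod (imp D (i, j)))\<^sup>2 * line_I y (i, j) t)"

definition flow_non_anticipative :: "('w, 'x) opf_data \<Rightarrow> ('w \<Rightarrow> flow_vars) \<Rightarrow> bool" where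
  "flow_non_anticipative D y \<longleftrightarrow>
     non_anticipative D (\<lambda>\<omega>. s_slack (y \<omega>)) \<and>
     (\<forall>i\<in>nonslack D.
        non_anticipative D (\<lambda>\<omega>. s_bus (y \<omega>) i) \<and>
        non_anticipative D (\<lambda>\<omega>. p_inj (y \<omega>) i) \<and>
        non_anticipative D (\<lambda>\<omega>. p_abs (y \<omega>) i) \<and>
        non_anticipative D (\<lambda>\<omega>. q_inj (y \<omega>) i) \<and>
        non_anticipative D (\<lambda>\<omega>. charge (y \<omega>) i)) \<and>
     (\<forall>e\<in>edges D.
        non_anticipative D (\<lambda>\<omega>. line_S (y \<omega>) e) \<and>
        non_anticipative D (\<lambda>\<omega>. line_I (y \<omega>) e)) \<and>
     (\<forall>i\<in>buses D. non_anticipative D (\<lambda>\<omega>. volt (y \<omega>) i))"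

definition base_constraints :: "('w, 'x) opf_data \<Rightarrow> ('w \<Rightarrow> flow_vars) \<Rightarrow> bool" where
  "base_constraints D y \<longleftrightarrow>
     (\<forall>\<omega>. bound_constraints D (y \<omega>) \<and> storage_constraints D (y \<omega>) \<and>
          injection_constraints D \<omega> (y \<omega>) \<and> balance_constraints D (y \<omega>) \<and>
          voltage_constraints D (y \<omega>)) \<and>
     flow_non_anticipative D y"

definition nonconvex_constraints :: "('w, 'x) opf_data \<Rightarrow> ('w \<Rightarrow> flow_vars) \<Rightarrow> bool" where
  "nonconvex_constraints D y \<longleftrightarrow> (\<forall>\<omega>. \<forall>t\<le>horizon D. \<forall>(i, j)\<in>edges D.
     volt (y \<omega>) i t * line_I (y \<omega>) (i, j) t = (cmod (line_S (y \<omega>) (i, j) t))\<^sup>2)"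

definition soc_constraints :: "('w, 'x) opf_data \<Rightarrow> ('w \<Rightarrow> flow_vars) \<Rightarrow> bool" where
  "soc_constraints D y \<longleftrightarrow> (\<forall>\<omega>. \<forall>t\<le>horizon D. \<forall>(i, j)\<in>edges D.
     volt (y \<omega>) i t * line_I (y \<omega>) (i, j) t \<ge> (cmod (line_S (y \<omega>) (i, j) t))\<^sup>2)"

definition restriction_constraints ::
  "('w, 'x) opf_data \<Rightarrow> ('w \<Rightarrow> flow_vars) \<Rightarrow> ('w \<Rightarrow> lin_vars) \<Rightarrow> bool" where
  "restriction_constraints D y l \<longleftrightarrow>
     (\<forall>\<omega>. \<forall>t\<le>horizon D.
        lin_volt (l \<omega>) 0 t = 1 \<and>
        (\<forall>i\<in>buses D. lin_volt (l \<omega>) i t \<le> v_hi D i) \<and>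
        (\<forall>(i, j)\<in>edges D.
           lin_S (l \<omega>) (i, j) t =
             (\<Sum>k | (k, i) \<in> edges D. lin_S (l \<omega>) (k, i) t) + s_bus (y \<omega>) i t) \<and>
        0 = (\<Sum>k | (k, 0) \<in> edges D. lin_S (l \<omega>) (k, 0) t) + lin_s_slack (l \<omega>) t \<and>
        (\<forall>(i, j)\<in>edges D.
           lin_volt (l \<omega>) i t - lin_volt (l \<omega>) j t =
             2 * Re (cnj (imp D (i, j)) * lin_S (l \<omega>) (i, j) t)) \<and>
        (\<forall>(i, j)\<in>edges D. \<forall>e\<in>subtree_edges D i.
           Re (cnj (imp D e) * lin_S (l \<omega>) (i, j) t) \<le> 0))"

definition lin_non_anticipative :: "('w, 'x) opf_data \<Rightarrow> ('w \<Rightarrow> lin_vars) \<Rightarrow> bool" where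
  "lin_non_anticipative D l \<longleftrightarrow>
     non_anticipative D (\<lambda>\<omega>. lin_s_slack (l \<omega>)) \<and>
     (\<forall>e\<in>edges D. non_anticipative D (\<lambda>\<omega>. lin_S (l \<omega>) e)) \<and>
     (\<forall>i\<in>buses D. non_anticipative D (\<lambda>\<omega>. lin_volt (l \<omega>) i))"


section \<open>Cost functions\<close>

definition agree_on_network :: "('w, 'x) opf_data \<Rightarrow> cost_vars \<Rightarrow> cost_vars \<Rightarrow> bool" where
  "agree_on_network D a b \<longleftrightarrow> (\<forall>t\<le>horizon D.
     s_slack a t = s_slack b t \<and>
     (\<forall>i\<in>nonslack D. p_inj a i t = p_inj b i t \<and> p_abs a i t = p_abs b i t \<and>
        q_inj a i t = q_inj b i t \<and> charge a i t = charge b i t) \<and>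
     (\<forall>e\<in>edges D. line_S a e t = line_S b e t \<and> line_I a e t = line_I b e t) \<and>
     (\<forall>i\<in>buses D. volt a i t = volt b i t))"

definition cost_well_defined ::
  "('w, 'x) opf_data \<Rightarrow> ('w \<Rightarrow> cost_vars \<Rightarrow> real) \<Rightarrow> bool" where
  "cost_well_defined D C \<longleftrightarrow> (\<forall>\<omega> a b. agree_on_network D a b \<longrightarrow> C \<omega> a = C \<omega> b)"

text \<open>The cost is that of a whole scenario, so it may use all information revealed up to the
  final time, and nothing else about \<open>\<omega>\<close>.\<close>

definition cost_adapted ::
  "('w, 'x) opf_data \<Rightarrow> ('w \<Rightarrow> cost_vars \<Rightarrow> real) \<Rightarrow> bool" where
  "cost_adapted D C \<longleftrightarrow>
     (\<forall>\<omega> \<omega>'. indistinguishable D (horizon D) \<omega> \<omega>' \<longrightarrow> C \<omega> = C \<omega>')"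

definition lin_comb :: "real \<Rightarrow> cost_vars \<Rightarrow> real \<Rightarrow> cost_vars \<Rightarrow> cost_vars" where
  "lin_comb u a w b = \<lparr>
     s_slack = (\<lambda>t. u *\<^sub>R s_slack a t + w *\<^sub>R s_slack b t),
     p_inj = (\<lambda>i t. u * p_inj a i t + w * p_inj b i t),
     p_abs = (\<lambda>i t. u * p_abs a i t + w * p_abs b i t),
     q_inj = (\<lambda>i t. u * q_inj a i t + w * q_inj b i t),
     charge = (\<lambda>i t. u * charge a i t + w * charge b i t),
     line_S = (\<lambda>e t. u *\<^sub>R line_S a e t + w *\<^sub>R line_S b e t),
     line_I = (\<lambda>e t. u * line_I a e t + w * line_I b e t),
     volt = (\<lambda>i t. u * volt a i t + w * volt b i t)\<rparr>"

text \<open>Convexity on the whole space, spelled out because function spaces are not an instance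
  of the class required by \<^const>\<open>convex_on\<close>.\<close>

definition cost_convex :: "('w \<Rightarrow> cost_vars \<Rightarrow> real) \<Rightarrow> bool" where
  "cost_convex C \<longleftrightarrow> (\<forall>\<omega> a b u w. 0 \<le> u \<and> 0 \<le> w \<and> u + w = 1 \<longrightarrow>
     C \<omega> (lin_comb u a w b) \<le> u * C \<omega> a + w * C \<omega> b)"

text \<open>In \<open>sep_vars\<close> the real parts, imaginary parts and moduli of the line flows are independent
  arguments; \<open>separate\<close> evaluates them at actual flows.\<close>

record sep_vars =
  sep_Re_s_slack :: "nat \<Rightarrow> real"
  sep_Im_s_slack :: "nat \<Rightarrow> real"
  sep_p_inj :: "nat \<Rightarrow> nat \<Rightarrow> real"
  sep_p_abs :: "nat \<Rightarrow> nat \<Rightarrow> real"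
  sep_q_inj :: "nat \<Rightarrow> nat \<Rightarrow> real"
  sep_charge :: "nat \<Rightarrow> nat \<Rightarrow> real"
  sep_Re_S :: "nat \<times> nat \<Rightarrow> nat \<Rightarrow> real"
  sep_Im_S :: "nat \<times> nat \<Rightarrow> nat \<Rightarrow> real"
  sep_abs_S :: "nat \<times> nat \<Rightarrow> nat \<Rightarrow> real"
  sep_I :: "nat \<times> nat \<Rightarrow> nat \<Rightarrow> real"
  sep_volt :: "nat \<Rightarrow> nat \<Rightarrow> real"

definition separate :: "cost_vars \<Rightarrow> sep_vars" where
  "separate a = \<lparr>
     sep_Re_s_slack = (\<lambda>t. Re (s_slack a t)),
     sep_Im_s_slack = (\<lambda>t. Im (s_slack a t)),
     sep_p_inj = p_inj a,
     sep_p_abs = p_abs a,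
     sep_q_inj = q_inj a,
     sep_charge = charge a,
     sep_Re_S = (\<lambda>e t. Re (line_S a e t)),
     sep_Im_S = (\<lambda>e t. Im (line_S a e t)),
     sep_abs_S = (\<lambda>e t. cmod (line_S a e t)),
     sep_I = line_I a,
     sep_volt = volt a\<rparr>"

definition upd2 :: "('a \<Rightarrow> nat \<Rightarrow> real) \<Rightarrow> 'a \<Rightarrow> nat \<Rightarrow> real \<Rightarrow> 'a \<Rightarrow> nat \<Rightarrow> real" where
  "upd2 f i t x = f(i := (f i)(t := x))"

text \<open>Monotonicity in every single component, all others being fixed.  Arguments standing for
  moduli range over nonnegative reals only.\<close>

definition componentwise_monotone :: "('w, 'x) opf_data \<Rightarrow> (sep_vars \<Rightarrow> real) \<Rightarrow> bool" where
  "componentwise_monotone D F \<longleftrightarrow>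
     (\<forall>a. (\<forall>e t. 0 \<le> sep_abs_S a e t) \<longrightarrow> (\<forall>t\<le>horizon D.
        mono (\<lambda>x. F (a\<lparr>sep_Re_s_slack := (sep_Re_s_slack a)(t := x)\<rparr>)) \<and>
        mono (\<lambda>x. F (a\<lparr>sep_Im_s_slack := (sep_Im_s_slack a)(t := x)\<rparr>)) \<and>
        (\<forall>e\<in>edges D.
           antimono (\<lambda>x. F (a\<lparr>sep_Re_S := upd2 (sep_Re_S a) e t x\<rparr>)) \<and>
           antimono (\<lambda>x. F (a\<lparr>sep_Im_S := upd2 (sep_Im_S a) e t x\<rparr>)) \<and>
           mono_on {0..} (\<lambda>x. F (a\<lparr>sep_abs_S := upd2 (sep_abs_S a) e t x\<rparr>)) \<and>
           mono (\<lambda>x. F (a\<lparr>sep_I := upd2 (sep_I a) e t x\<rparr>))) \<and>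
        (\<forall>i\<in>buses D.
           antimono (\<lambda>x. F (a\<lparr>sep_volt := upd2 (sep_volt a) i t x\<rparr>)))))"

definition cost_monotone ::
  "('w, 'x) opf_data \<Rightarrow> ('w \<Rightarrow> cost_vars \<Rightarrow> real) \<Rightarrow> bool" where
  "cost_monotone D C \<longleftrightarrow>
     (\<forall>\<omega>. \<exists>F. (\<forall>a. C \<omega> a = F (separate a)) \<and> componentwise_monotone D F)"


section \<open>The three problems and their values\<close>

definition expected_cost ::
  "('w, 'x) opf_data \<Rightarrow> ('w \<Rightarrow> cost_vars \<Rightarrow> real) \<Rightarrow> ('w \<Rightarrow> flow_vars) \<Rightarrow> real" where
  "expected_cost D C y = measure_pmf.expectation (prob D) (\<lambda>\<omega>. C \<omega> (cost_vars.truncate (y \<omega>)))"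

definition val_P :: "('w, 'x) opf_data \<Rightarrow> ('w \<Rightarrow> cost_vars \<Rightarrow> real) \<Rightarrow> ereal" where
  "val_P D C =
     (INF y \<in> {y. base_constraints D y \<and> nonconvex_constraints D y}. ereal (expected_cost D C y))"

definition val_SOC :: "('w, 'x) opf_data \<Rightarrow> ('w \<Rightarrow> cost_vars \<Rightarrow> real) \<Rightarrow> ereal" where
  "val_SOC D C =
     (INF y \<in> {y. base_constraints D y \<and> soc_constraints D y}. ereal (expected_cost D C y))"

definition val_SOC_restricted :: "('w, 'x) opf_data \<Rightarrow> ('w \<Rightarrow> cost_vars \<Rightarrow> real) \<Rightarrow> ereal" where
  "val_SOC_restricted D C =
     (INF (y, l) \<in> {(y, l). base_constraints D y \<and> soc_constraints D y \<and>
                            restriction_constraints D y l \<and> lin_non_anticipative D l}.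
        ereal (expected_cost D C y))"

end

theory Submission
  imports Defs
begin

text \<open>The values are compared by turning every feasible point of the restricted relaxation into a
  feasible point of the exact problem that costs no more, keeping all bus injections and storage
  decisions; subtracting the value of the relaxation from both sides is then harmless.

  In a radial network the line flows are determined by the injections and the squared currents
  \<open>J\<close>: writing \<open>L\<close> for the lossless flow \<open>S\<^sup>L\<^sup>i\<^sup>n\<close>, the flow leaving bus \<open>i\<close> is
  \<open>S(J) = L - (\<Sum> z J)\<close>, summed over the sub-tree of \<open>i\<close>, and the squared voltages \<open>v(J)\<close> are sums of
  voltage drops along the path to the root.  The exact constraint \<open>v I = |S|\<^sup>2\<close> asks for a fixed point
  of \<open>J \<mapsto> |S(J)|\<^sup>2 / v(J)\<close>.  Because impedances have nonnegative real and imaginary parts, lowering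
  \<open>J\<close> raises \<open>Re S\<close>, \<open>Im S\<close> and \<open>v\<close>.  It also lowers \<open>|S|\<close>: the restriction says that \<open>L\<close> makes an
  obtuse angle with every downstream impedance, so that losses, which are added in the direction
  \<open>- z\<close>, can only lengthen the flow (\<open>cmod_flow_mono_in_losses\<close>).  The map is therefore monotone, and
  the relaxed constraint says that it maps the given currents \<open>I\<close> below themselves.  By the
  Knaster-Tarski argument (\<open>box_fixed_point\<close>) it has a fixed point between \<open>0\<close> and \<open>I\<close>
  (\<open>ex_exact_improvement\<close>).

  At the fixed point \<open>I\<close>, \<open>|S|\<close> and the slack injection have not increased, and \<open>Re S\<close>, \<open>Im S\<close> and \<open>v\<close>
  have not decreased, which is the direction in which the cost is monotone
  (\<open>cost_mono_finite_changes\<close>).  Apart from \<open>I \<ge> 0\<close>, the only bounds at stake in that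
  direction are the upper voltage bounds, and they hold since \<open>v(J)\<close> stays below the lossless voltage \<open>v\<^sup>L\<^sup>i\<^sup>n\<close>.  The problem at
  one time step involves the data of that time step only, so choosing the improvement as a function
  of these data preserves non-anticipativity (\<open>exact_solution_of_restricted\<close>).\<close>

section \<open>Fixed points of monotone maps on boxes\<close>

text \<open>The Knaster-Tarski construction: the pointwise infimum of all pre-fixed points in the box.
  It is carried out by hand because real-valued functions form no complete lattice; the box
  provides the bounds that conditional completeness of the reals asks for.\<close>

lemma box_fixed_point:
  fixes \<Phi> :: "('a \<Rightarrow> real) \<Rightarrow> 'a \<Rightarrow> real"
  assumes lu: "l \<le> u"
    and mono: "\<And>J K. l \<le> J \<Longrightarrow> J \<le> K \<Longrightarrow> K \<le> u \<Longrightarrow> \<Phi> J \<le> \<Phi> K"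
    and low: "l \<le> \<Phi> l" and up: "\<Phi> u \<le> u"
  obtains J where "l \<le> J" "J \<le> u" "\<Phi> J = J"
proof -
  define P where "P = {J. l \<le> J \<and> J \<le> u \<and> \<Phi> J \<le> J}"
  define M where "M = (\<lambda>e. Inf ((\<lambda>J. J e) ` P))"
  have uP: "u \<in> P" using lu up by (simp add: P_def)
  have bdd: "bdd_below ((\<lambda>J. J e) ` P)" for e
    by (rule bdd_belowI[of _ "l e"]) (auto simp: P_def le_fun_def)
  have M_le: "M \<le> J" if "J \<in> P" for J
    unfolding M_def le_fun_def using that bdd by (auto intro!: cInf_lower)
  have M_greatest: "K \<le> M" if "\<And>J. J \<in> P \<Longrightarrow> K \<le> J" for K
    unfolding M_def le_fun_def
    using uP that by (auto intro!: cInf_greatest simp: le_fun_def)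
  have lM: "l \<le> M" by (rule M_greatest) (simp add: P_def)
  have Mu: "M \<le> u" using M_le uP .
  have le: "\<Phi> M \<le> M"
  proof (rule M_greatest)
    fix J assume J: "J \<in> P"
    then have "\<Phi> M \<le> \<Phi> J" using mono[OF lM M_le[OF J]] by (simp add: P_def)
    with J show "\<Phi> M \<le> J" by (auto simp: P_def intro: order_trans)
  qed
  have lPhi: "l \<le> \<Phi> M" using low mono[of l M] lM Mu by (auto intro: order_trans)
  have "\<Phi> (\<Phi> M) \<le> \<Phi> M" using mono[OF lPhi le Mu] .
  then have "\<Phi> M \<in> P" using lPhi le Mu by (auto simp: P_def intro: order_trans)
  then have "M \<le> \<Phi> M" by (rule M_le)
  with le lM Mu show ?thesis using that by (meson antisym)
qed


section \<open>Sums along a rooted tree\<close>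

definition upstream_edges :: "('w, 'x) opf_data \<Rightarrow> nat \<Rightarrow> (nat \<times> nat) set" where
  "upstream_edges D i = {(k, l) \<in> edges D. (i, k) \<in> (edges D)\<^sup>*}"

locale radial_network =
  fixes D :: "('w, 'x) opf_data"
  assumes radial: "radial_connected D"
begin

lemma edge_in_buses: "(i, j) \<in> edges D \<Longrightarrow> i \<in> nonslack D \<and> j \<in> buses D"
  using radial unfolding radial_connected_def nonslack_def by auto

lemma finite_edges: "finite (edges D)"
proof (rule finite_subset)
  show "edges D \<subseteq> buses D \<times> buses D" using radial by (simp add: radial_connected_def)
qed (simp add: buses_def)

lemma parent_unique: "(i, j) \<in> edges D \<Longrightarrow> (i, k) \<in> edges D \<Longrightarrow> j = k"
  using edge_in_buses radial unfolding radial_connected_def by blast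

text \<open>Parents being unique, whatever is reachable from a cycle lies on a cycle; but the root is
  reachable from everywhere and has no parent.\<close>

lemma acyclic_edges: "acyclic (edges D)"
proof (rule acyclicI, intro allI notI)
  fix i assume cyc: "(i, i) \<in> (edges D)\<^sup>+"
  have spread: "(x, x) \<in> (edges D)\<^sup>+" if "(i, x) \<in> (edges D)\<^sup>*" for x
    using that
  proof (induction rule: rtrancl_induct)
    case (step x y)
    then have "(y, x) \<in> (edges D)\<^sup>*" using parent_unique by (metis tranclD)
    with step show ?case by (meson rtrancl_into_trancl1)
  qed (rule cyc)
  from cyc have "i \<in> buses D" using edge_in_buses by (metis tranclD nonslack_def DiffD1)
  then have "(i, 0) \<in> (edges D)\<^sup>*" using radial by (simp add: radial_connected_def)
  then have "(0, 0) \<in> (edges D)\<^sup>+" by (rule spread)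
  then show False using radial unfolding radial_connected_def by (metis tranclD)
qed

lemma wf_edges: "wf (edges D)"
  using finite_edges acyclic_edges by (rule finite_acyclic_wf)

lemma finite_subtree_edges: "finite (subtree_edges D i)"
  by (rule finite_subset[OF _ finite_edges]) (auto simp: subtree_edges_def)

lemma finite_upstream_edges: "finite (upstream_edges D i)"
  by (rule finite_subset[OF _ finite_edges]) (auto simp: upstream_edges_def)

lemma finite_children: "finite {k. (k, i) \<in> edges D}"
  by (rule finite_subset[OF _ finite_imageI[OF finite_edges, of fst]]) force

lemma no_return: "(k, i) \<in> edges D \<Longrightarrow> (i, k) \<notin> (edges D)\<^sup>*"
  using acyclic_edges by (meson acyclic_def rtrancl_into_trancl1)

lemma subtree_edges_iff: "(k, l) \<in> subtree_edges D i \<longleftrightarrow> (k, l) \<in> edges D \<and> (l, i) \<in> (edges D)\<^sup>*"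
  by (auto simp: subtree_edges_def intro: converse_rtrancl_into_rtrancl)

text \<open>A common descendant has only one path towards the root, so one of the two siblings would lie
  above the other; the path between them would pass through their parent and close a cycle.\<close>

lemma siblings_share_no_descendant:
  assumes "(k, i) \<in> edges D" "(k', i) \<in> edges D" "(l, k) \<in> (edges D)\<^sup>*" "(l, k') \<in> (edges D)\<^sup>*"
  shows "k = k'"
proof -
  have not_below: "a = b" if "(a, b) \<in> (edges D)\<^sup>*" "(a, i) \<in> edges D" "(b, i) \<in> edges D" for a b
    using that(1)
  proof (cases rule: converse_rtranclE)
    case (step c)
    then have "c = i" using parent_unique that(2) by blast
    with step that(3) no_return show ?thesis by blast
  qed
  have "single_valued (edges D)" using parent_unique by (auto simp: single_valued_def)
  then have "(k, k') \<in> (edges D)\<^sup>* \<or> (k', k) \<in> (edges D)\<^sup>*"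
    using single_valued_confluent assms(3,4) by metis
  then show ?thesis using not_below assms(1,2) by metis
qed

text \<open>This recursion is the shape of the power balance equations; it makes sums over sub-trees
  solve them.\<close>

lemma sum_subtree_edges:
  fixes f :: "nat \<times> nat \<Rightarrow> 'b :: comm_monoid_add"
  shows "sum f (subtree_edges D i)
    = (\<Sum>k | (k, i) \<in> edges D. f (k, i) + sum f (subtree_edges D k))"
proof -
  let ?B = "\<lambda>k. insert (k, i) (subtree_edges D k)"
  have "subtree_edges D i = (\<Union>k\<in>{k. (k, i) \<in> edges D}. ?B k)"
  proof (intro set_eqI iffI)
    fix e assume "e \<in> subtree_edges D i"
    then obtain m l where e: "e = (m, l)" "(m, l) \<in> edges D" "(l, i) \<in> (edges D)\<^sup>*"
      by (cases e) (auto simp: subtree_edges_iff)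
    from e(3) show "e \<in> (\<Union>k\<in>{k. (k, i) \<in> edges D}. ?B k)"
      by (cases rule: rtranclE) (use e in \<open>auto simp: subtree_edges_iff\<close>)
  next
    fix e assume "e \<in> (\<Union>k\<in>{k. (k, i) \<in> edges D}. ?B k)"
    then show "e \<in> subtree_edges D i"
      by (cases e) (auto simp: subtree_edges_iff intro: rtrancl_into_rtrancl)
  qed
  moreover have "sum f (\<Union>k\<in>{k. (k, i) \<in> edges D}. ?B k)
      = (\<Sum>k | (k, i) \<in> edges D. sum f (?B k))"
  proof (rule sum.UNION_disjoint)
    show "\<forall>k\<in>{k. (k, i) \<in> edges D}. \<forall>k'\<in>{k. (k, i) \<in> edges D}. k \<noteq> k' \<longrightarrow> ?B k \<inter> ?B k' = {}"
      using siblings_share_no_descendant no_return by (fastforce simp: subtree_edges_iff)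
  qed (auto simp: finite_children finite_subtree_edges)
  moreover have "sum f (?B k) = f (k, i) + sum f (subtree_edges D k)" if "(k, i) \<in> edges D" for k
    using that no_return by (simp add: finite_subtree_edges subtree_edges_iff)
  ultimately show ?thesis by simp
qed

text \<open>The corresponding recursion for the voltage equations, which proceed from the root.\<close>

lemma sum_upstream_edges:
  fixes f :: "nat \<times> nat \<Rightarrow> 'b :: comm_monoid_add"
  assumes "(i, j) \<in> edges D"
  shows "sum f (upstream_edges D i) = f (i, j) + sum f (upstream_edges D j)"
proof -
  have "upstream_edges D i = insert (i, j) (upstream_edges D j)"
  proof (intro set_eqI iffI)
    fix e assume "e \<in> upstream_edges D i"
    then obtain k l where e: "e = (k, l)" "(k, l) \<in> edges D" "(i, k) \<in> (edges D)\<^sup>*"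
      by (cases e) (auto simp: upstream_edges_def)
    from e(3) show "e \<in> insert (i, j) (upstream_edges D j)"
      by (cases rule: converse_rtranclE)
        (use e assms parent_unique in \<open>auto simp: upstream_edges_def\<close>)
  qed (use assms in \<open>auto simp: upstream_edges_def intro: converse_rtrancl_into_rtrancl\<close>)
  moreover have "(i, j) \<notin> upstream_edges D j"
    using assms no_return by (auto simp: upstream_edges_def)
  ultimately show ?thesis by (simp add: finite_upstream_edges)
qed

lemma upstream_edges_root: "upstream_edges D 0 = {}"
proof -
  have "k = 0" if "(0, k) \<in> (edges D)\<^sup>*" for k
    using that edge_in_buses by (auto simp: nonslack_def elim: converse_rtranclE)
  then show ?thesis using edge_in_buses by (fastforce simp: upstream_edges_def nonslack_def)
qed

lemma potential_eq_sum_upstream: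
  fixes v g :: "_ \<Rightarrow> real"
  assumes "v 0 = c" "\<And>i j. (i, j) \<in> edges D \<Longrightarrow> v i - v j = g (i, j)" "i \<in> buses D"
  shows "v i = c + sum g (upstream_edges D i)"
proof -
  have "(i, 0) \<in> (edges D)\<^sup>*" using radial assms(3) by (simp add: radial_connected_def)
  then show ?thesis
  proof (induction rule: converse_rtrancl_induct)
    case base
    then show ?case using assms(1) by (simp add: upstream_edges_root)
  next
    case (step i j)
    then show ?case using assms(2)[of i j] sum_upstream_edges[of i j g] by simp
  qed
qed

text \<open>Uniqueness for the balance equations with losses \<open>h\<close>, by induction from the leaves; it identifies the given flows with the explicit formula.\<close>

lemma flow_eq_lossless_minus_losses:
  fixes S L :: "nat \<times> nat \<Rightarrow> complex"
  assumes S: "\<And>i j. (i, j) \<in> edges D \<Longrightarrow>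
      S (i, j) = (\<Sum>k | (k, i) \<in> edges D. S (k, i) - h (k, i)) + s i"
    and L: "\<And>i j. (i, j) \<in> edges D \<Longrightarrow> L (i, j) = (\<Sum>k | (k, i) \<in> edges D. L (k, i)) + s i"
    and e: "(i, j) \<in> edges D"
  shows "S (i, j) = L (i, j) - sum h (subtree_edges D i)"
  using e
proof (induction i arbitrary: j rule: wf_induct_rule[OF wf_edges])
  case (1 i)
  have "S (i, j) = (\<Sum>k | (k, i) \<in> edges D. L (k, i) - (h (k, i) + sum h (subtree_edges D k))) + s i"
    unfolding S[OF 1(2)] by (simp add: 1(1) algebra_simps)
  also have "\<dots> = L (i, j) - sum h (subtree_edges D i)"
    by (simp add: L[OF 1(2)] sum_subtree_edges[of h i] sum_subtractf)
  finally show ?case .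
qed

lemma lossless_minus_losses_balanced:
  fixes L :: "nat \<times> nat \<Rightarrow> complex"
  assumes "S = (\<lambda>e. L e - sum h (subtree_edges D (fst e)))"
  shows "(\<Sum>k | (k, i) \<in> edges D. S (k, i) - h (k, i))
    = (\<Sum>k | (k, i) \<in> edges D. L (k, i)) - sum h (subtree_edges D i)"
  by (simp add: assms sum_subtree_edges[of h i] sum_subtractf sum.distrib)

end


section \<open>Losses against the direction of flow\<close>

lemma Re_cnj_mult_nonneg:
  assumes "0 \<le> Re a" "0 \<le> Im a" "0 \<le> Re b" "0 \<le> Im b"
  shows "0 \<le> Re (cnj a * b)"
  using assms by simp

lemma Re_cnj_mult_commute: "Re (cnj a * b) = Re (cnj b * a)"
  by simp

text \<open>\<open>Re (cnj a * b)\<close> is the inner product of \<open>a\<close> and \<open>b\<close> as vectors of the plane; the following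
  lemma is its linearity in the second argument.\<close>

lemma Re_cnj_mult_sum_scaled:
  "Re (cnj w * (\<Sum>e\<in>A. z e * of_real (J e))) = (\<Sum>e\<in>A. J e * Re (cnj w * z e))"
  unfolding sum_distrib_left Re_sum
  by (rule sum.cong) (auto simp: algebra_simps)

lemma cmod_diff_squared: "(cmod (a - b))\<^sup>2 = (cmod a)\<^sup>2 - 2 * Re (cnj a * b) + (cmod b)\<^sup>2"
  unfolding cmod_power2 by (simp add: power2_eq_square algebra_simps)

text \<open>Subtracting nonnegative multiples of the \<open>z e\<close> keeps the angle of \<open>L\<close> with each \<open>z f\<close> obtuse, because any two
  of the impedances make an acute angle.  So the flow with losses \<open>J\<close> still points away from the
  additional losses, and subtracting these cannot shorten it.\<close>

lemma cmod_flow_mono_in_losses: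
  fixes z :: "'e \<Rightarrow> complex" and L :: complex
  assumes z: "\<And>e. e \<in> A \<Longrightarrow> 0 \<le> Re (z e) \<and> 0 \<le> Im (z e)"
    and L: "\<And>e. e \<in> A \<Longrightarrow> Re (cnj (z e) * L) \<le> 0"
    and J: "\<And>e. e \<in> A \<Longrightarrow> 0 \<le> J e \<and> J e \<le> K e"
  shows "cmod (L - (\<Sum>e\<in>A. z e * of_real (J e))) \<le> cmod (L - (\<Sum>e\<in>A. z e * of_real (K e)))"
proof -
  let ?a = "L - (\<Sum>e\<in>A. z e * of_real (J e))"
  let ?d = "\<Sum>e\<in>A. z e * of_real (K e - J e)"
  have flow: "Re (cnj (z e) * ?a) \<le> 0" if "e \<in> A" for e
  proof -
    have "0 \<le> (\<Sum>f\<in>A. J f * Re (cnj (z e) * z f))"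
      using J z that by (intro sum_nonneg mult_nonneg_nonneg Re_cnj_mult_nonneg) auto
    then show ?thesis
      using L[OF that] by (simp only: right_diff_distrib minus_complex.sel Re_cnj_mult_sum_scaled)
  qed
  have "Re (cnj ?a * ?d) = (\<Sum>e\<in>A. (K e - J e) * Re (cnj ?a * z e))"
    by (rule Re_cnj_mult_sum_scaled)
  also have "\<dots> \<le> 0"
  proof (rule sum_nonpos)
    fix e assume e: "e \<in> A"
    have "Re (cnj ?a * z e) = Re (cnj (z e) * ?a)"
      by (rule Re_cnj_mult_commute)
    then have "Re (cnj ?a * z e) \<le> 0" using flow[OF e] by (simp only:)
    then show "(K e - J e) * Re (cnj ?a * z e) \<le> 0"
      using J[OF e] by (intro mult_nonneg_nonpos) auto
  qed
  finally have inner: "Re (cnj ?a * ?d) \<le> 0" .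
  have "(cmod (?a - ?d))\<^sup>2 = (cmod ?a)\<^sup>2 - 2 * Re (cnj ?a * ?d) + (cmod ?d)\<^sup>2"
    by (rule cmod_diff_squared)
  then have "(cmod ?a)\<^sup>2 \<le> (cmod (?a - ?d))\<^sup>2" using inner zero_le_power2[of "cmod ?d"] by linarith
  moreover have "?a - ?d = L - (\<Sum>e\<in>A. z e * of_real (K e))"
    by (simp add: right_diff_distrib sum_subtractf)
  ultimately show ?thesis by (metis norm_ge_zero power2_le_imp_le)
qed


section \<open>Exact improvements at one time step\<close>

text \<open>The new flows, currents, voltages and slack injection at one time step, relative to the old
  ones.  The upper voltage bounds and \<open>0 \<le> I'\<close> are listed because the comparison with the old
  values does not imply them.  The old data enter as snapshots, so that the predicate visibly
  depends on one time step only.\<close>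

definition exact_improvement ::
  "('w, 'x) opf_data \<Rightarrow> (nat \<Rightarrow> complex) \<Rightarrow>
   (nat \<times> nat \<Rightarrow> complex) \<Rightarrow> (nat \<times> nat \<Rightarrow> real) \<Rightarrow> (nat \<Rightarrow> real) \<Rightarrow> complex \<Rightarrow>
   (nat \<times> nat \<Rightarrow> complex) \<Rightarrow> (nat \<times> nat \<Rightarrow> real) \<Rightarrow> (nat \<Rightarrow> real) \<Rightarrow> complex \<Rightarrow> bool" where
  "exact_improvement D s S I v s0 S' I' v' s0' \<longleftrightarrow>
     v' 0 = 1 \<and> (\<forall>i\<in>nonslack D. v i \<le> v' i \<and> v' i \<le> v_hi D i) \<and>
     (\<forall>e\<in>edges D. 0 \<le> I' e \<and> I' e \<le> I e \<and> cmod (S' e) \<le> cmod (S e) \<and>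
        Re (S e) \<le> Re (S' e) \<and> Im (S e) \<le> Im (S' e)) \<and>
     (\<forall>(i, j)\<in>edges D.
        S' (i, j) = (\<Sum>k | (k, i) \<in> edges D. S' (k, i) - imp D (k, i) * of_real (I' (k, i))) + s i) \<and>
     0 = (\<Sum>k | (k, 0) \<in> edges D. S' (k, 0) - imp D (k, 0) * of_real (I' (k, 0))) + s0' \<and>
     Re s0' \<le> Re s0 \<and> Im s0' \<le> Im s0 \<and>
     (\<forall>(i, j)\<in>edges D. v' i - v' j =
        2 * Re (cnj (imp D (i, j)) * S' (i, j)) - (cmod (imp D (i, j)))\<^sup>2 * I' (i, j)) \<and>
     (\<forall>(i, j)\<in>edges D. v' i * I' (i, j) = (cmod (S' (i, j)))\<^sup>2)"

text \<open>Scenarios that agree on the network at a time step admit the same improvements there; this is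
  what makes a choice of improvement non-anticipative.\<close>

lemma exact_improvement_cong:
  assumes "\<And>i. i \<in> nonslack D \<Longrightarrow> s i = t i" "\<And>e. e \<in> edges D \<Longrightarrow> S e = T e"
    "\<And>e. e \<in> edges D \<Longrightarrow> I e = J e" "\<And>i. i \<in> nonslack D \<Longrightarrow> v i = w i"
    and "\<And>i j. (i, j) \<in> edges D \<Longrightarrow> i \<in> nonslack D"
  shows "exact_improvement D s S I v s0 = exact_improvement D t T J w s0"
proof (intro ext)
  fix S' I' v' s0'
  have "(\<forall>(i, j)\<in>edges D. S' (i, j) = G i + s i) \<longleftrightarrow> (\<forall>(i, j)\<in>edges D. S' (i, j) = G i + t i)"
    for G
    using assms(1,5) by (intro ball_cong) auto
  then show "exact_improvement D s S I v s0 S' I' v' s0' = exact_improvement D t T J w s0 S' I' v' s0'"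
    unfolding exact_improvement_def using assms(2,3,4) by simp
qed

locale passive_radial_network = radial_network D for D :: "('w, 'x) opf_data" +
  assumes passive_net: "passive_network D"
begin

lemma imp_nonneg: "e \<in> edges D \<Longrightarrow> 0 \<le> Re (imp D e) \<and> 0 \<le> Im (imp D e)"
  using passive_net by (simp add: passive_network_def)

text \<open>The fixed point of \<open>cur\<close> below the given currents.  Positivity of \<open>v\<close> is needed to divide by
  \<open>vol J\<close>, which is at least \<open>v\<close> everywhere in the box.\<close>

lemma ex_exact_improvement:
  fixes S L :: "nat \<times> nat \<Rightarrow> complex" and I :: "nat \<times> nat \<Rightarrow> real" and v w :: "nat \<Rightarrow> real"
  assumes v0: "v 0 = 1"
    and v_pos: "\<And>i. i \<in> nonslack D \<Longrightarrow> 0 < v i"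
    and I_nonneg: "\<And>e. e \<in> edges D \<Longrightarrow> 0 \<le> I e"
    and balance: "\<And>i j. (i, j) \<in> edges D \<Longrightarrow>
      S (i, j) = (\<Sum>k | (k, i) \<in> edges D. S (k, i) - imp D (k, i) * of_real (I (k, i))) + s i"
    and slack: "0 = (\<Sum>k | (k, 0) \<in> edges D. S (k, 0) - imp D (k, 0) * of_real (I (k, 0))) + s0"
    and voltage: "\<And>i j. (i, j) \<in> edges D \<Longrightarrow>
      v i - v j = 2 * Re (cnj (imp D (i, j)) * S (i, j)) - (cmod (imp D (i, j)))\<^sup>2 * I (i, j)"
    and soc: "\<And>i j. (i, j) \<in> edges D \<Longrightarrow> (cmod (S (i, j)))\<^sup>2 \<le> v i * I (i, j)"
    and lin_balance: "\<And>i j. (i, j) \<in> edges D \<Longrightarrow> L (i, j) = (\<Sum>k | (k, i) \<in> edges D. L (k, i)) + s i"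
    and w0: "w 0 = 1"
    and w_hi: "\<And>i. i \<in> buses D \<Longrightarrow> w i \<le> v_hi D i"
    and lin_voltage: "\<And>i j. (i, j) \<in> edges D \<Longrightarrow> w i - w j = 2 * Re (cnj (imp D (i, j)) * L (i, j))"
    and reverse: "\<And>i j e. (i, j) \<in> edges D \<Longrightarrow> e \<in> subtree_edges D i \<Longrightarrow>
      Re (cnj (imp D e) * L (i, j)) \<le> 0"
  shows "\<exists>S' I' v' s0'. exact_improvement D s S I v s0 S' I' v' s0'"
proof -
  define loss where "loss J e = imp D e * complex_of_real (J e)" for J e
  define flow where "flow J = (\<lambda>e. L e - sum (loss J) (subtree_edges D (fst e)))" for J
  define drop where "drop J e = 2 * Re (cnj (imp D e) * flow J e) - (cmod (imp D e))\<^sup>2 * J e" for J e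
  define vol where "vol J i = 1 + sum (drop J) (upstream_edges D i)" for J i
  define cur where "cur J e = (if e \<in> edges D then (cmod (flow J e))\<^sup>2 / vol J (fst e) else 0)" for J e
  \<comment> \<open>Cut off outside the network, where nothing is known about the sign of \<open>I\<close>.\<close>
  define U where "U e = (if e \<in> edges D then I e else 0)" for e

  have sub: "f \<in> edges D" if "f \<in> subtree_edges D i" for f i
    using that by (auto simp: subtree_edges_def)
  have up: "f \<in> edges D" if "f \<in> upstream_edges D i" for f i
    using that by (auto simp: upstream_edges_def)
  \<comment> \<open>The explicit flows and voltages at the given currents are the given ones.\<close>
  have flow_U: "flow U e = S e" if "e \<in> edges D" for e
  proof -
    obtain i j where e: "e = (i, j)" by (cases e)
    have *: "S (i, j) = (\<Sum>k | (k, i) \<in> edges D. S (k, i) - loss U (k, i)) + s i"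
      if "(i, j) \<in> edges D" for i j
      using balance[OF that] by (simp add: loss_def U_def)
    show ?thesis
      using flow_eq_lossless_minus_losses[OF * lin_balance, of i j] that e by (simp add: flow_def)
  qed
  have vol_U: "vol U i = v i" if "i \<in> buses D" for i
    using potential_eq_sum_upstream[of v 1 "drop U" i] v0 voltage that
    by (simp add: vol_def drop_def flow_U U_def)
  have flow_balance: "flow J (i, j) = (\<Sum>k | (k, i) \<in> edges D. flow J (k, i) - loss J (k, i)) + s i"
    if "(i, j) \<in> edges D" for J i j
    using lossless_minus_losses_balanced[of "flow J" L "loss J" i] lin_balance[OF that]
    by (simp add: flow_def)
  have vol_diff: "vol J i - vol J j = drop J (i, j)" if "(i, j) \<in> edges D" for J i j
    using sum_upstream_edges[OF that, of "drop J"] by (simp add: vol_def)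

  \<comment> \<open>Fewer losses: higher flow components, smaller drops, higher voltages, shorter flows.\<close>
  have flow_antimono: "Re (flow K e) \<le> Re (flow J e)" "Im (flow K e) \<le> Im (flow J e)"
    if "J \<le> K" for J K e
    using that imp_nonneg sub unfolding flow_def loss_def
    by (auto intro!: sum_mono mult_left_mono simp: le_fun_def)
  have drop_antimono: "drop K e \<le> drop J e" if "J \<le> K" "e \<in> edges D" for J K e
  proof -
    have "Re (cnj (imp D e) * flow K e) \<le> Re (cnj (imp D e) * flow J e)"
      using flow_antimono[OF that(1), of e] imp_nonneg[OF that(2)]
      by (auto intro!: add_mono mult_left_mono)
    moreover have "(cmod (imp D e))\<^sup>2 * J e \<le> (cmod (imp D e))\<^sup>2 * K e"
      using le_funD[OF that(1)] by (intro mult_left_mono) auto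
    ultimately show ?thesis by (simp add: drop_def)
  qed
  have vol_antimono: "vol K i \<le> vol J i" if "J \<le> K" for J K i
    unfolding vol_def using drop_antimono[OF that] up by (auto intro!: sum_mono)
  have vol_pos: "0 < vol J i" if "J \<le> U" "i \<in> nonslack D" for J i
    using vol_antimono[OF that(1), of i] vol_U[of i] v_pos[OF that(2)] that(2)
    by (auto simp: nonslack_def)
  have flow_mono: "cmod (flow J e) \<le> cmod (flow K e)"
    if "(\<lambda>_. 0) \<le> J" "J \<le> K" "e \<in> edges D" for J K e
    using that reverse[of "fst e" "snd e"] imp_nonneg sub
    unfolding flow_def loss_def by (intro cmod_flow_mono_in_losses) (auto simp: le_fun_def)
  have fst_nonslack: "fst e \<in> nonslack D" if "e \<in> edges D" for e
    using that edge_in_buses by (cases e) auto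

  obtain J where J: "(\<lambda>_. 0) \<le> J" "J \<le> U" "cur J = J"
  proof (rule box_fixed_point[of "\<lambda>_. 0" U cur])
    show "(\<lambda>_. 0) \<le> U" using I_nonneg by (auto simp: U_def le_fun_def)
    then show "(\<lambda>_. 0) \<le> cur (\<lambda>_. 0)" using vol_pos fst_nonslack
      by (auto simp: cur_def le_fun_def intro!: divide_nonneg_pos)
    show "cur U \<le> U"
      using soc v_pos edge_in_buses
      by (auto simp: cur_def U_def le_fun_def flow_U vol_U nonslack_def divide_le_eq mult.commute)
    fix J K :: "nat \<times> nat \<Rightarrow> real" assume JK: "(\<lambda>_. 0) \<le> J" "J \<le> K" "K \<le> U"
    show "cur J \<le> cur K"
      using JK vol_pos fst_nonslack flow_mono vol_antimono
      by (auto simp: cur_def le_fun_def intro!: frac_le power_mono)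
  qed

  let ?s0 = "- (\<Sum>k | (k, 0) \<in> edges D. flow J (k, 0) - loss J (k, 0))"
  have slack_U: "s0 = - (\<Sum>k | (k, 0) \<in> edges D. flow U (k, 0) - loss U (k, 0))"
  proof -
    have "(\<Sum>k | (k, 0) \<in> edges D. flow U (k, 0) - loss U (k, 0))
        = (\<Sum>k | (k, 0) \<in> edges D. S (k, 0) - imp D (k, 0) * of_real (I (k, 0)))"
      by (rule sum.cong) (auto simp: flow_U loss_def U_def)
    then show ?thesis using slack by (simp add: add_eq_0_iff)
  qed
  have slack_le: "Re ?s0 \<le> Re s0" "Im ?s0 \<le> Im s0"
    unfolding slack_U loss_def using flow_antimono[OF J(2)] J(2) imp_nonneg
    by (auto intro!: sum_mono diff_mono mult_left_mono simp: le_fun_def)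
  have vol_lin: "vol J i \<le> w i" if "i \<in> buses D" for i
  proof -
    have "drop J e \<le> 2 * Re (cnj (imp D e) * L e)" if e: "e \<in> edges D" for e
    proof -
      \<comment> \<open>Without currents there are no losses, and the drop is the lossless one.\<close>
      have "drop J e \<le> drop (\<lambda>_. 0) e" using J(1) e by (intro drop_antimono) (auto simp: le_fun_def)
      then show ?thesis by (simp add: drop_def flow_def loss_def)
    qed
    then have "vol J i \<le> 1 + (\<Sum>e\<in>upstream_edges D i. 2 * Re (cnj (imp D e) * L e))"
      unfolding vol_def using up by (auto intro!: sum_mono)
    also have "\<dots> = w i" using potential_eq_sum_upstream[of w 1 "\<lambda>e. 2 * Re (cnj (imp D e) * L e)" i]
      w0 lin_voltage that by simp
    finally show ?thesis .
  qed
  have exact: "vol J i * J (i, j) = (cmod (flow J (i, j)))\<^sup>2" if "(i, j) \<in> edges D" for i j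
  proof -
    have "J (i, j) = cur J (i, j)" using J(3) by simp
    then show ?thesis using vol_pos[OF J(2), of i] edge_in_buses[OF that] that by (simp add: cur_def)
  qed
  have "exact_improvement D s S I v s0 (flow J) J (vol J) ?s0"
    unfolding exact_improvement_def
  proof (intro conjI)
    show "vol J 0 = 1" by (simp add: vol_def upstream_edges_root)
    show "\<forall>i\<in>nonslack D. v i \<le> vol J i \<and> vol J i \<le> v_hi D i"
    proof (intro ballI)
      fix i assume "i \<in> nonslack D"
      then have "i \<in> buses D" by (simp add: nonslack_def)
      then show "v i \<le> vol J i \<and> vol J i \<le> v_hi D i"
        using vol_antimono[OF J(2), of i] vol_U[of i] vol_lin[of i] w_hi[of i] by simp
    qed
    show "\<forall>e\<in>edges D. 0 \<le> J e \<and> J e \<le> I e \<and> cmod (flow J e) \<le> cmod (S e) \<and>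
        Re (S e) \<le> Re (flow J e) \<and> Im (S e) \<le> Im (flow J e)"
    proof (intro ballI)
      fix e assume e: "e \<in> edges D"
      have "0 \<le> J e \<and> J e \<le> I e" using le_funD[OF J(1), of e] le_funD[OF J(2), of e] e by (simp add: U_def)
      then show "0 \<le> J e \<and> J e \<le> I e \<and> cmod (flow J e) \<le> cmod (S e) \<and>
          Re (S e) \<le> Re (flow J e) \<and> Im (S e) \<le> Im (flow J e)"
        using flow_antimono[OF J(2), of e] flow_mono[OF J(1,2) e] flow_U[OF e] by simp
    qed
    show "\<forall>(i, j)\<in>edges D. flow J (i, j) =
        (\<Sum>k | (k, i) \<in> edges D. flow J (k, i) - imp D (k, i) * of_real (J (k, i))) + s i"
      using flow_balance by (auto simp: loss_def)
    show "0 = (\<Sum>k | (k, 0) \<in> edges D. flow J (k, 0) - imp D (k, 0) * of_real (J (k, 0))) + ?s0"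
      by (simp add: loss_def)
    show "\<forall>(i, j)\<in>edges D. vol J i - vol J j =
        2 * Re (cnj (imp D (i, j)) * flow J (i, j)) - (cmod (imp D (i, j)))\<^sup>2 * J (i, j)"
      using vol_diff by (auto simp: drop_def)
    show "\<forall>(i, j)\<in>edges D. vol J i * J (i, j) = (cmod (flow J (i, j)))\<^sup>2"
      using exact by auto
  qed (use slack_le in auto)
  then show ?thesis by blast
qed

end


section \<open>Costs under finitely many monotone changes\<close>

text \<open>Replacing the values of \<open>f\<close> by those of \<open>g\<close> one index at a time reduces a change of finitely
  many values to the single updates in which componentwise monotonicity is stated.\<close>

lemma finite_update_chain:
  fixes f g :: "'k \<Rightarrow> 'b"
  assumes "finite A" and off: "\<And>k. k \<notin> A \<Longrightarrow> f k = g k"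
    and step: "\<And>h k. k \<in> A \<Longrightarrow> (\<And>j. h j = f j \<or> h j = g j) \<Longrightarrow>
      (H (h(k := g k)) :: 'c :: preorder) \<le> H (h(k := f k))"
  shows "H g \<le> H f"
proof -
  have "H (\<lambda>k. if k \<in> B then g k else f k) \<le> H f" if "B \<subseteq> A" "finite B" for B
    using that(2,1)
  proof (induction B)
    case (insert b B)
    let ?h = "\<lambda>k. if k \<in> B then g k else f k"
    have "H (?h(b := g b)) \<le> H (?h(b := f b))" using insert by (intro step) auto
    moreover have "?h(b := f b) = ?h" using insert by auto
    moreover have "?h(b := g b) = (\<lambda>k. if k \<in> insert b B then g k else f k)" by auto
    ultimately show ?case using insert by (auto intro: order_trans)
  qed simp
  moreover have "(\<lambda>k. if k \<in> A then g k else f k) = g" using off by auto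
  ultimately show ?thesis using assms(1) by (metis order_refl)
qed

lemma finite_upd2_chain:
  fixes f g :: "'a \<Rightarrow> nat \<Rightarrow> real" and H :: "('a \<Rightarrow> nat \<Rightarrow> real) \<Rightarrow> real"
  assumes "finite A" and off: "\<And>i t. \<not> (i \<in> A \<and> t \<le> T) \<Longrightarrow> f i t = g i t"
    and step: "\<And>h i t. i \<in> A \<Longrightarrow> t \<le> T \<Longrightarrow> (\<And>j u. h j u = f j u \<or> h j u = g j u) \<Longrightarrow>
      H (upd2 h i t (g i t)) \<le> H (upd2 h i t (f i t))"
  shows "H g \<le> H f"
proof -
  have upd: "(\<lambda>i t. (h(k := x)) (i, t)) = upd2 (\<lambda>i t. h (i, t)) (fst k) (snd k) x"
    for h :: "'a \<times> nat \<Rightarrow> real" and k x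
    by (cases k) (auto simp: upd2_def fun_eq_iff)
  have "H (\<lambda>i t. (\<lambda>(i, t). g i t) (i, t)) \<le> H (\<lambda>i t. (\<lambda>(i, t). f i t) (i, t))"
  proof (rule finite_update_chain[where H = "\<lambda>h. H (\<lambda>i t. h (i, t))" and A = "A \<times> {..T}"])
    fix h :: "'a \<times> nat \<Rightarrow> real" and k
    assume "k \<in> A \<times> {..T}" and h: "\<And>j. h j = (case j of (i, t) \<Rightarrow> f i t) \<or> h j = (case j of (i, t) \<Rightarrow> g i t)"
    then obtain i t where k: "k = (i, t)" "i \<in> A" "t \<le> T" by auto
    have "h (j, u) = f j u \<or> h (j, u) = g j u" for j u using h[of "(j, u)"] by simp
    then show "H (\<lambda>i t. (h(k := case k of (i, t) \<Rightarrow> g i t)) (i, t))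
        \<le> H (\<lambda>i t. (h(k := case k of (i, t) \<Rightarrow> f i t)) (i, t))"
      unfolding upd using step[of i t "\<lambda>i t. h (i, t)"] k by simp
  qed (use assms(1) off in auto)
  then show ?thesis by simp
qed

text \<open>The seven families are changed one after the other.  The intermediate arguments, where for
  instance \<open>absS\<close> is not the modulus of the flow with parts \<open>reS\<close> and \<open>imS\<close>, are why monotonicity
  has to be known for separate arguments; only nonnegativity of the moduli is maintained.\<close>

lemma cost_mono_finite_changes:
  fixes F :: "sep_vars \<Rightarrow> real"
  assumes mono: "componentwise_monotone D F"
    and fin: "finite (edges D)"
    and b: "b = a\<lparr>sep_Re_s_slack := re, sep_Im_s_slack := im, sep_Re_S := reS, sep_Im_S := imS,
      sep_abs_S := absS, sep_I := cur, sep_volt := vol\<rparr>"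
    and off: "\<And>t. \<not> t \<le> horizon D \<Longrightarrow> re t = sep_Re_s_slack a t \<and> im t = sep_Im_s_slack a t"
    and off_edges: "\<And>e t. \<not> (e \<in> edges D \<and> t \<le> horizon D) \<Longrightarrow>
      reS e t = sep_Re_S a e t \<and> imS e t = sep_Im_S a e t \<and> absS e t = sep_abs_S a e t \<and> cur e t = sep_I a e t"
    and off_buses: "\<And>i t. \<not> (i \<in> buses D \<and> t \<le> horizon D) \<Longrightarrow> vol i t = sep_volt a i t"
    and nonneg: "\<And>e t. 0 \<le> sep_abs_S a e t" "\<And>e t. 0 \<le> absS e t"
    and slack: "\<And>t. t \<le> horizon D \<Longrightarrow> re t \<le> sep_Re_s_slack a t \<and> im t \<le> sep_Im_s_slack a t"
    and lines: "\<And>e t. e \<in> edges D \<Longrightarrow> t \<le> horizon D \<Longrightarrow> sep_Re_S a e t \<le> reS e t \<and>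
      sep_Im_S a e t \<le> imS e t \<and> absS e t \<le> sep_abs_S a e t \<and> cur e t \<le> sep_I a e t"
    and volts: "\<And>i t. i \<in> buses D \<Longrightarrow> t \<le> horizon D \<Longrightarrow> sep_volt a i t \<le> vol i t"
  shows "F b \<le> F a"
proof -
  have M: "mono (\<lambda>x. F (c\<lparr>sep_Re_s_slack := (sep_Re_s_slack c)(t := x)\<rparr>))"
    "mono (\<lambda>x. F (c\<lparr>sep_Im_s_slack := (sep_Im_s_slack c)(t := x)\<rparr>))"
    "e \<in> edges D \<Longrightarrow> antimono (\<lambda>x. F (c\<lparr>sep_Re_S := upd2 (sep_Re_S c) e t x\<rparr>))"
    "e \<in> edges D \<Longrightarrow> antimono (\<lambda>x. F (c\<lparr>sep_Im_S := upd2 (sep_Im_S c) e t x\<rparr>))"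
    "e \<in> edges D \<Longrightarrow> mono_on {0..} (\<lambda>x. F (c\<lparr>sep_abs_S := upd2 (sep_abs_S c) e t x\<rparr>))"
    "e \<in> edges D \<Longrightarrow> mono (\<lambda>x. F (c\<lparr>sep_I := upd2 (sep_I c) e t x\<rparr>))"
    "i \<in> buses D \<Longrightarrow> antimono (\<lambda>x. F (c\<lparr>sep_volt := upd2 (sep_volt c) i t x\<rparr>))"
    if "\<And>e t. 0 \<le> sep_abs_S c e t" "t \<le> horizon D" for c e i t
    using mono that unfolding componentwise_monotone_def by blast+
  have fin_buses: "finite (buses D)" by (simp add: buses_def)

  have slack_Re: "F (c\<lparr>sep_Re_s_slack := re\<rparr>) \<le> F c"
    if c: "\<And>e t. 0 \<le> sep_abs_S c e t" "sep_Re_s_slack c = sep_Re_s_slack a" for c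
  proof -
    have "F (c\<lparr>sep_Re_s_slack := re\<rparr>) \<le> F (c\<lparr>sep_Re_s_slack := sep_Re_s_slack c\<rparr>)"
    proof (rule finite_update_chain[where H = "\<lambda>h. F (c\<lparr>sep_Re_s_slack := h\<rparr>)" and A = "{..horizon D}"])
      fix h t assume "t \<in> {..horizon D}"
      then show "F (c\<lparr>sep_Re_s_slack := h(t := re t)\<rparr>)
          \<le> F (c\<lparr>sep_Re_s_slack := h(t := sep_Re_s_slack c t)\<rparr>)"
        using monoD[OF M(1)[of "c\<lparr>sep_Re_s_slack := h\<rparr>" t]] c slack by simp
    qed (use off c in auto)
    then show ?thesis by simp
  qed
  have slack_Im: "F (c\<lparr>sep_Im_s_slack := im\<rparr>) \<le> F c"
    if c: "\<And>e t. 0 \<le> sep_abs_S c e t" "sep_Im_s_slack c = sep_Im_s_slack a" for c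
  proof -
    have "F (c\<lparr>sep_Im_s_slack := im\<rparr>) \<le> F (c\<lparr>sep_Im_s_slack := sep_Im_s_slack c\<rparr>)"
    proof (rule finite_update_chain[where H = "\<lambda>h. F (c\<lparr>sep_Im_s_slack := h\<rparr>)" and A = "{..horizon D}"])
      fix h t assume "t \<in> {..horizon D}"
      then show "F (c\<lparr>sep_Im_s_slack := h(t := im t)\<rparr>)
          \<le> F (c\<lparr>sep_Im_s_slack := h(t := sep_Im_s_slack c t)\<rparr>)"
        using monoD[OF M(2)[of "c\<lparr>sep_Im_s_slack := h\<rparr>" t]] c slack by simp
    qed (use off c in auto)
    then show ?thesis by simp
  qed
  have line_Re: "F (c\<lparr>sep_Re_S := reS\<rparr>) \<le> F c"
    if c: "\<And>e t. 0 \<le> sep_abs_S c e t" "sep_Re_S c = sep_Re_S a" for c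
  proof -
    have "F (c\<lparr>sep_Re_S := reS\<rparr>) \<le> F (c\<lparr>sep_Re_S := sep_Re_S c\<rparr>)"
    proof (rule finite_upd2_chain[where H = "\<lambda>h. F (c\<lparr>sep_Re_S := h\<rparr>)"
          and A = "edges D" and T = "horizon D"])
      fix h i t
      assume "i \<in> edges D" "t \<le> horizon D"
      then show "F (c\<lparr>sep_Re_S := upd2 h i t (reS i t)\<rparr>)
          \<le> F (c\<lparr>sep_Re_S := upd2 h i t (sep_Re_S c i t)\<rparr>)"
        using antimonoD[OF M(3)[of "c\<lparr>sep_Re_S := h\<rparr>" t i]] c lines by simp
    qed (use fin off_edges c in auto)
    then show ?thesis by simp
  qed
  have line_Im: "F (c\<lparr>sep_Im_S := imS\<rparr>) \<le> F c"
    if c: "\<And>e t. 0 \<le> sep_abs_S c e t" "sep_Im_S c = sep_Im_S a" for c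
  proof -
    have "F (c\<lparr>sep_Im_S := imS\<rparr>) \<le> F (c\<lparr>sep_Im_S := sep_Im_S c\<rparr>)"
    proof (rule finite_upd2_chain[where H = "\<lambda>h. F (c\<lparr>sep_Im_S := h\<rparr>)"
          and A = "edges D" and T = "horizon D"])
      fix h i t
      assume "i \<in> edges D" "t \<le> horizon D"
      then show "F (c\<lparr>sep_Im_S := upd2 h i t (imS i t)\<rparr>)
          \<le> F (c\<lparr>sep_Im_S := upd2 h i t (sep_Im_S c i t)\<rparr>)"
        using antimonoD[OF M(4)[of "c\<lparr>sep_Im_S := h\<rparr>" t i]] c lines by simp
    qed (use fin off_edges c in auto)
    then show ?thesis by simp
  qed
  have line_abs: "F (c\<lparr>sep_abs_S := absS\<rparr>) \<le> F c"
    if c: "\<And>e t. 0 \<le> sep_abs_S c e t" "sep_abs_S c = sep_abs_S a" for c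
  proof -
    have "F (c\<lparr>sep_abs_S := absS\<rparr>) \<le> F (c\<lparr>sep_abs_S := sep_abs_S c\<rparr>)"
    proof (rule finite_upd2_chain[where H = "\<lambda>h. F (c\<lparr>sep_abs_S := h\<rparr>)"
          and A = "edges D" and T = "horizon D"])
      fix h i t
      assume "i \<in> edges D" "t \<le> horizon D" "\<And>j u. h j u = sep_abs_S c j u \<or> h j u = absS j u"
      moreover from this(3) have "0 \<le> h j u" for j u
        using c(1) nonneg(2) by metis
      ultimately show "F (c\<lparr>sep_abs_S := upd2 h i t (absS i t)\<rparr>)
          \<le> F (c\<lparr>sep_abs_S := upd2 h i t (sep_abs_S c i t)\<rparr>)"
        using mono_onD[OF M(5)[of "c\<lparr>sep_abs_S := h\<rparr>" t i]] c nonneg lines by simp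
    qed (use fin off_edges c in auto)
    then show ?thesis by simp
  qed
  have line_cur: "F (c\<lparr>sep_I := cur\<rparr>) \<le> F c"
    if c: "\<And>e t. 0 \<le> sep_abs_S c e t" "sep_I c = sep_I a" for c
  proof -
    have "F (c\<lparr>sep_I := cur\<rparr>) \<le> F (c\<lparr>sep_I := sep_I c\<rparr>)"
    proof (rule finite_upd2_chain[where H = "\<lambda>h. F (c\<lparr>sep_I := h\<rparr>)"
          and A = "edges D" and T = "horizon D"])
      fix h i t
      assume "i \<in> edges D" "t \<le> horizon D"
      then show "F (c\<lparr>sep_I := upd2 h i t (cur i t)\<rparr>)
          \<le> F (c\<lparr>sep_I := upd2 h i t (sep_I c i t)\<rparr>)"
        using monoD[OF M(6)[of "c\<lparr>sep_I := h\<rparr>" t i]] c lines by simp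
    qed (use fin off_edges c in auto)
    then show ?thesis by simp
  qed
  have bus_vol: "F (c\<lparr>sep_volt := vol\<rparr>) \<le> F c"
    if c: "\<And>e t. 0 \<le> sep_abs_S c e t" "sep_volt c = sep_volt a" for c
  proof -
    have "F (c\<lparr>sep_volt := vol\<rparr>) \<le> F (c\<lparr>sep_volt := sep_volt c\<rparr>)"
    proof (rule finite_upd2_chain[where H = "\<lambda>h. F (c\<lparr>sep_volt := h\<rparr>)"
          and A = "buses D" and T = "horizon D"])
      fix h i t
      assume "i \<in> buses D" "t \<le> horizon D"
      then show "F (c\<lparr>sep_volt := upd2 h i t (vol i t)\<rparr>)
          \<le> F (c\<lparr>sep_volt := upd2 h i t (sep_volt c i t)\<rparr>)"
        using antimonoD[OF M(7)[of "c\<lparr>sep_volt := h\<rparr>" t i]] c volts by simp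
    qed (use fin_buses off_buses c in auto)
    then show ?thesis by simp
  qed

  have "F b \<le> F (a\<lparr>sep_Re_s_slack := re, sep_Im_s_slack := im, sep_Re_S := reS, sep_Im_S := imS,
      sep_abs_S := absS, sep_I := cur\<rparr>)"
    unfolding b by (rule bus_vol) (simp_all add: nonneg)
  also have "\<dots> \<le> F (a\<lparr>sep_Re_s_slack := re, sep_Im_s_slack := im, sep_Re_S := reS,
      sep_Im_S := imS, sep_abs_S := absS\<rparr>)"
    by (rule line_cur) (simp_all add: nonneg)
  also have "\<dots> \<le> F (a\<lparr>sep_Re_s_slack := re, sep_Im_s_slack := im, sep_Re_S := reS, sep_Im_S := imS\<rparr>)"
    by (rule line_abs) (simp_all add: nonneg)
  also have "\<dots> \<le> F (a\<lparr>sep_Re_s_slack := re, sep_Im_s_slack := im, sep_Re_S := reS\<rparr>)"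
    by (rule line_Im) (simp_all add: nonneg)
  also have "\<dots> \<le> F (a\<lparr>sep_Re_s_slack := re, sep_Im_s_slack := im\<rparr>)"
    by (rule line_Re) (simp_all add: nonneg)
  also have "\<dots> \<le> F (a\<lparr>sep_Re_s_slack := re\<rparr>)"
    by (rule slack_Im) (simp_all add: nonneg)
  also have "\<dots> \<le> F a"
    by (rule slack_Re) (simp_all add: nonneg)
  finally show ?thesis .
qed


section \<open>From the restricted relaxation to the exact problem\<close>

context passive_radial_network begin

text \<open>Improvements are chosen separately for each scenario and time step, by a choice that depends on
  the predicate \<open>Q \<omega> t\<close> alone.  Indistinguishable scenarios give the same predicate, hence the same
  choice.  Off the network and beyond the horizon the old values are kept, so that only finitely
  many components of the cost argument change.\<close>

lemma exact_solution_of_restricted: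
  fixes y :: "'w \<Rightarrow> flow_vars" and l :: "'w \<Rightarrow> lin_vars"
  assumes v_lo_pos: "\<And>i. i \<in> nonslack D \<Longrightarrow> 0 < v_lo D i"
    and monotone: "cost_monotone D C"
    and base: "base_constraints D y" and soc: "soc_constraints D y"
    and restriction: "restriction_constraints D y l"
  obtains y' where "base_constraints D y'" "nonconvex_constraints D y'"
    "\<And>\<omega>. C \<omega> (cost_vars.truncate (y' \<omega>)) \<le> C \<omega> (cost_vars.truncate (y \<omega>))"
proof -
  define Q where "Q \<omega> t = exact_improvement D (\<lambda>i. s_bus (y \<omega>) i t) (\<lambda>e. line_S (y \<omega>) e t)
    (\<lambda>e. line_I (y \<omega>) e t) (\<lambda>i. volt (y \<omega>) i t) (s_slack (y \<omega>) t)" for \<omega> t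
  define sol where "sol \<omega> t = (SOME p. Q \<omega> t (fst p) (fst (snd p)) (fst (snd (snd p))) (snd (snd (snd p))))" for \<omega> t
  define S' where "S' \<omega> t = fst (sol \<omega> t)" for \<omega> t
  define I' where "I' \<omega> t = fst (snd (sol \<omega> t))" for \<omega> t
  define v' where "v' \<omega> t = fst (snd (snd (sol \<omega> t)))" for \<omega> t
  define s0' where "s0' \<omega> t = snd (snd (snd (sol \<omega> t)))" for \<omega> t

  have constraints: "bound_constraints D (y \<omega>)" "storage_constraints D (y \<omega>)"
    "injection_constraints D \<omega> (y \<omega>)" "balance_constraints D (y \<omega>)" "voltage_constraints D (y \<omega>)" for \<omega>
    using base by (auto simp: base_constraints_def)
  have na: "flow_non_anticipative D y" using base by (simp add: base_constraints_def)

  have ex: "\<exists>S' I' v' s0'. Q \<omega> t S' I' v' s0'" if t: "t \<le> horizon D" for \<omega> t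
    unfolding Q_def
  proof (rule ex_exact_improvement[where L = "\<lambda>e. lin_S (l \<omega>) e t" and w = "\<lambda>i. lin_volt (l \<omega>) i t"])
    show "volt (y \<omega>) 0 t = 1" using constraints(1) t by (simp add: bound_constraints_def)
    show "0 < volt (y \<omega>) i t" if "i \<in> nonslack D" for i
      using constraints(1)[of \<omega>] t that v_lo_pos[OF that] by (force simp: bound_constraints_def)
    show "0 \<le> line_I (y \<omega>) e t" if "e \<in> edges D" for e
      using constraints(1)[of \<omega>] t that by (force simp: bound_constraints_def)
    show "(cmod (line_S (y \<omega>) (i, j) t))\<^sup>2 \<le> volt (y \<omega>) i t * line_I (y \<omega>) (i, j) t"
      if "(i, j) \<in> edges D" for i j
      using soc t that by (force simp: soc_constraints_def)
    show "lin_volt (l \<omega>) i t \<le> v_hi D i" if "i \<in> buses D" for i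
      using restriction t that by (simp add: restriction_constraints_def)
    show "Re (cnj (imp D e) * lin_S (l \<omega>) (i, j) t) \<le> 0"
      if "(i, j) \<in> edges D" "e \<in> subtree_edges D i" for i j e
      using restriction t that unfolding restriction_constraints_def by fast
  qed (use constraints(4,5)[of \<omega>] restriction t in
      \<open>fastforce simp: balance_constraints_def voltage_constraints_def restriction_constraints_def\<close>)+
  have Q: "Q \<omega> t (S' \<omega> t) (I' \<omega> t) (v' \<omega> t) (s0' \<omega> t)" if "t \<le> horizon D" for \<omega> t
  proof -
    from ex[OF that] have "\<exists>p. Q \<omega> t (fst p) (fst (snd p)) (fst (snd (snd p))) (snd (snd (snd p)))"
      by force
    then show ?thesis unfolding S'_def I'_def v'_def s0'_def sol_def by (rule someI_ex)
  qed

  have sol_na: "sol \<omega> t = sol \<omega>' t" if "t \<le> horizon D" "indistinguishable D t \<omega> \<omega>'" for \<omega> \<omega>' t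
  proof -
    have "s_slack (y \<omega>) t = s_slack (y \<omega>') t"
      using na that by (simp add: flow_non_anticipative_def non_anticipative_def)
    moreover have "Q \<omega> t = exact_improvement D (\<lambda>i. s_bus (y \<omega>') i t) (\<lambda>e. line_S (y \<omega>') e t)
      (\<lambda>e. line_I (y \<omega>') e t) (\<lambda>i. volt (y \<omega>') i t) (s_slack (y \<omega>) t)"
      unfolding Q_def
      by (rule exact_improvement_cong)
        (use na that edge_in_buses in
          \<open>auto simp: flow_non_anticipative_def non_anticipative_def nonslack_def\<close>)
    ultimately have "Q \<omega> t = Q \<omega>' t" by (simp add: Q_def)
    then show ?thesis by (simp add: sol_def)
  qed

  define y' where "y' \<omega> = (y \<omega>)\<lparr>
    s_slack := (\<lambda>t. if t \<le> horizon D then s0' \<omega> t else s_slack (y \<omega>) t),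
    line_S := (\<lambda>e t. if e \<in> edges D \<and> t \<le> horizon D then S' \<omega> t e else line_S (y \<omega>) e t),
    line_I := (\<lambda>e t. if e \<in> edges D \<and> t \<le> horizon D then I' \<omega> t e else line_I (y \<omega>) e t),
    volt := (\<lambda>i t. if i \<in> buses D \<and> t \<le> horizon D then v' \<omega> t i else volt (y \<omega>) i t)\<rparr>" for \<omega>
  note Q = Q[unfolded Q_def exact_improvement_def]
  have zero: "0 \<in> buses D" and nonslack_bus: "i \<in> nonslack D \<Longrightarrow> i \<in> buses D" for i
    by (simp_all add: buses_def nonslack_def)

  have v': "v' \<omega> t 0 = 1" "i \<in> nonslack D \<Longrightarrow> volt (y \<omega>) i t \<le> v' \<omega> t i \<and> v' \<omega> t i \<le> v_hi D i"
    and lines: "e \<in> edges D \<Longrightarrow> 0 \<le> I' \<omega> t e \<and> I' \<omega> t e \<le> line_I (y \<omega>) e t \<and>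
      cmod (S' \<omega> t e) \<le> cmod (line_S (y \<omega>) e t) \<and>
      Re (line_S (y \<omega>) e t) \<le> Re (S' \<omega> t e) \<and> Im (line_S (y \<omega>) e t) \<le> Im (S' \<omega> t e)"
    and slack: "Re (s0' \<omega> t) \<le> Re (s_slack (y \<omega>) t)" "Im (s0' \<omega> t) \<le> Im (s_slack (y \<omega>) t)"
    if "t \<le> horizon D" for \<omega> t i e
    using Q[OF that, of \<omega>] by blast+
  have balanced: "(i, j) \<in> edges D \<Longrightarrow> S' \<omega> t (i, j) =
      (\<Sum>k | (k, i) \<in> edges D. S' \<omega> t (k, i) - imp D (k, i) * of_real (I' \<omega> t (k, i))) + s_bus (y \<omega>) i t"
    "0 = (\<Sum>k | (k, 0) \<in> edges D. S' \<omega> t (k, 0) - imp D (k, 0) * of_real (I' \<omega> t (k, 0))) + s0' \<omega> t"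
    "(i, j) \<in> edges D \<Longrightarrow> v' \<omega> t i - v' \<omega> t j =
      2 * Re (cnj (imp D (i, j)) * S' \<omega> t (i, j)) - (cmod (imp D (i, j)))\<^sup>2 * I' \<omega> t (i, j)"
    "(i, j) \<in> edges D \<Longrightarrow> v' \<omega> t i * I' \<omega> t (i, j) = (cmod (S' \<omega> t (i, j)))\<^sup>2"
    if "t \<le> horizon D" for \<omega> t i j
    using Q[OF that, of \<omega>] by blast+

  have "bound_constraints D (y' \<omega>)" for \<omega>
    unfolding bound_constraints_def
  proof (intro allI impI conjI ballI)
    fix t assume t: "t \<le> horizon D"
    note B = constraints(1)[of \<omega>, unfolded bound_constraints_def, rule_format, OF t]
    show "volt (y' \<omega>) 0 t = 1" using v'(1)[OF t] t zero by (simp add: y'_def)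
    fix i assume i: "i \<in> nonslack D"
    show "v_lo D i \<le> volt (y' \<omega>) i t" "volt (y' \<omega>) i t \<le> v_hi D i"
      using v'(2)[OF t i, where \<omega> = \<omega>] B i t nonslack_bus[OF i] by (auto simp: y'_def intro: order_trans)
    show "0 \<le> p_inj (y' \<omega>) i t" "p_inj (y' \<omega>) i t \<le> p_inj_hi D i"
      "0 \<le> p_abs (y' \<omega>) i t" "p_abs (y' \<omega>) i t \<le> p_abs_hi D i"
      "q_lo D i \<le> q_inj (y' \<omega>) i t" "q_inj (y' \<omega>) i t \<le> q_hi D i"
      using B i by (simp_all add: y'_def)
  next
    fix t e assume t: "t \<le> horizon D" and e: "e \<in> edges D"
    have "line_I (y \<omega>) e t \<le> I_hi D e" "cmod (line_S (y \<omega>) e t) \<le> S_hi D e"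
      using constraints(1)[of \<omega>] t e by (auto simp: bound_constraints_def)
    then show "0 \<le> line_I (y' \<omega>) e t" "line_I (y' \<omega>) e t \<le> I_hi D e" "cmod (line_S (y' \<omega>) e t) \<le> S_hi D e"
      using lines[OF t e, where \<omega> = \<omega>] t e by (auto simp: y'_def)
  qed
  moreover have "storage_constraints D (y' \<omega>)" for \<omega>
    using constraints(2)[of \<omega>] by (simp add: storage_constraints_def y'_def)
  moreover have "injection_constraints D \<omega> (y' \<omega>)" for \<omega>
    using constraints(3)[of \<omega>] by (simp add: injection_constraints_def y'_def)
  moreover have "balance_constraints D (y' \<omega>)" for \<omega>
    unfolding balance_constraints_def
  proof (intro allI impI conjI ballI)
    fix t assume t: "t \<le> horizon D"
    have children: "(\<Sum>k | (k, i) \<in> edges D. line_S (y' \<omega>) (k, i) t - imp D (k, i) * of_real (line_I (y' \<omega>) (k, i) t))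
        = (\<Sum>k | (k, i) \<in> edges D. S' \<omega> t (k, i) - imp D (k, i) * of_real (I' \<omega> t (k, i)))" for i
      by (rule sum.cong) (use t in \<open>auto simp: y'_def\<close>)
    have slack': "s_slack (y' \<omega>) t = s0' \<omega> t" using t by (simp add: y'_def)
    show "0 = (\<Sum>k | (k, 0) \<in> edges D. line_S (y' \<omega>) (k, 0) t
        - imp D (k, 0) * of_real (line_I (y' \<omega>) (k, 0) t)) + s_slack (y' \<omega>) t"
      unfolding children slack' by (rule balanced(2)[OF t])
    fix e assume e: "e \<in> edges D"
    obtain i j where ij: "e = (i, j)" by (cases e)
    have flow': "line_S (y' \<omega>) (i, j) t = S' \<omega> t (i, j)" and inj': "s_bus (y' \<omega>) i t = s_bus (y \<omega>) i t"
      using t e ij by (simp_all add: y'_def)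
    show "case e of (i, j) \<Rightarrow> line_S (y' \<omega>) (i, j) t =
        (\<Sum>k | (k, i) \<in> edges D. line_S (y' \<omega>) (k, i) t - imp D (k, i) * of_real (line_I (y' \<omega>) (k, i) t))
        + s_bus (y' \<omega>) i t"
      unfolding ij prod.case children flow' inj' using balanced(1)[OF t] e ij by blast
  qed
  moreover have "voltage_constraints D (y' \<omega>)" for \<omega>
    using balanced(3)[where \<omega> = \<omega>] edge_in_buses nonslack_bus
    unfolding voltage_constraints_def y'_def by auto
  moreover have "flow_non_anticipative D y'"
    using na sol_na
    unfolding flow_non_anticipative_def non_anticipative_def y'_def S'_def I'_def v'_def s0'_def
    by simp
  ultimately have "base_constraints D y'" by (simp add: base_constraints_def)
  moreover have "nonconvex_constraints D y'"
    using balanced(4) edge_in_buses nonslack_bus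
    unfolding nonconvex_constraints_def y'_def by auto
  moreover have "C \<omega> (cost_vars.truncate (y' \<omega>)) \<le> C \<omega> (cost_vars.truncate (y \<omega>))" for \<omega>
  proof -
    obtain F where F: "\<And>a. C \<omega> a = F (separate a)" "componentwise_monotone D F"
      using monotone unfolding cost_monotone_def by metis
    have v'_ge: "volt (y \<omega>) i t \<le> v' \<omega> t i" if "i \<in> buses D" "t \<le> horizon D" for i t
    proof (cases "i = 0")
      case True
      then show ?thesis using v'(1)[OF that(2)] constraints(1)[of \<omega>] that
        by (simp add: bound_constraints_def)
    next
      case False
      then show ?thesis using v'(2)[OF that(2), where \<omega> = \<omega> and i = i] that(1) by (simp add: nonslack_def)
    qed
    have "F (separate (cost_vars.truncate (y' \<omega>))) \<le> F (separate (cost_vars.truncate (y \<omega>)))"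
      by (rule cost_mono_finite_changes[OF F(2) finite_edges,
            where re = "\<lambda>t. Re (s_slack (y' \<omega>) t)" and im = "\<lambda>t. Im (s_slack (y' \<omega>) t)"
              and reS = "\<lambda>e t. Re (line_S (y' \<omega>) e t)" and imS = "\<lambda>e t. Im (line_S (y' \<omega>) e t)"
              and absS = "\<lambda>e t. cmod (line_S (y' \<omega>) e t)"
              and cur = "line_I (y' \<omega>)" and vol = "volt (y' \<omega>)"])
        (use lines[where \<omega> = \<omega>] slack[where \<omega> = \<omega>] v'_ge in
          \<open>auto simp: separate_def cost_vars.truncate_def y'_def\<close>)
    then show ?thesis by (simp add: F(1))
  qed
  ultimately show ?thesis by (rule that)
qed

end

theorem theorem2:
  fixes D :: "('w::finite, 'x) opf_data"
    and C :: "'w \<Rightarrow> cost_vars \<Rightarrow> real"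
  assumes radial: "radial_connected D"
    and passive_net: "passive_network D"
    and dur_pos: "\<And>t. t \<le> horizon D \<Longrightarrow> 0 < dur D t"
    and v_lo_pos: "\<And>i. i \<in> nonslack D \<Longrightarrow> 0 < v_lo D i"
    and well_defined: "cost_well_defined D C"
    and adapted: "cost_adapted D C"
    and convex: "cost_convex C"
    and monotone: "cost_monotone D C"
    and finite_val: "\<bar>val_SOC D C\<bar> \<noteq> \<infinity>"
  shows "val_P D C - val_SOC D C \<le> val_SOC_restricted D C - val_SOC D C"
proof (rule ereal_minus_mono[OF _ order_refl])
  interpret passive_radial_network D
    using radial passive_net by unfold_locales
  show "val_P D C \<le> val_SOC_restricted D C"
    unfolding val_SOC_restricted_def
  proof (rule INF_greatest, clarify)
    fix y l
    assume feasible: "base_constraints D y" "soc_constraints D y" "restriction_constraints D y l"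
    obtain y' where y': "base_constraints D y'" "nonconvex_constraints D y'"
        "\<And>\<omega>. C \<omega> (cost_vars.truncate (y' \<omega>)) \<le> C \<omega> (cost_vars.truncate (y \<omega>))"
      using exact_solution_of_restricted[OF v_lo_pos monotone feasible] by blast
    have "expected_cost D C y' \<le> expected_cost D C y"
      unfolding expected_cost_def
      by (intro integral_mono y'(3) integrable_measure_pmf_finite) simp_all
    moreover have "val_P D C \<le> ereal (expected_cost D C y')"
      unfolding val_P_def using y'(1,2) by (intro INF_lower) simp
    ultimately show "val_P D C \<le> ereal (expected_cost D C y)"
      using order_trans ereal_less_eq(3) by blast
  qed
qed

end
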